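(* There exist constants $c>0,c_1>0$ depending only on $d$ and $a$ (in particular independent of $k$, $m$, $L$, $\bar\mu_0\ge0$ and the size of $\Omega$) such that for all $x\in\Omega$ and $y\in\Omega_k$, $$|(G_k(\Omega)Q^*_{\Omega,k})(x,y)|\le c\,e^{-c_1|x-y|}.$$
   Context: Setup: $d\ge1$, odd integer $L>1$, integers $k\ge1$, $m\ge k$, $\eta=L^{-k}$, $\Omega=\eta\{0,\dots,L^m-1\}^d$, $\Omega_k=\{0,\dots,L^{m-k}-1\}^d$. $\mathcal L^2(\Omega)$ has inner product $\eta^d\sum_{x\in\Omega}\bar fg$ and $\mathcal L^2(\Omega_k)$ has $\sum_{y\in\Omega_k}\bar fg$. For $y\in\mathbb Z^d$, $B_k(y)=\{x\in\eta\mathbb Z^d: y_\mu\le x_\mu<y_\mu+1\ \forall\mu\}$; $(Q_{\Omega,k}f)(y)=L^{-kd}\sum_{x\in B_k(y)}f(x)$ for $y\in\Omega_k$, with adjoint $(Q^*_{\Omega,k}h)(x)=h(y_x)$, $x\in B_k(y_x)$. Neumann Laplacian $(\Delta^\eta_\Omega f)(x)=\eta^{-2}\sum_\mu(f(x+\eta e_\mu)-2f(x)+f(x-\eta e_\mu))$ with $f(x\pm\eta e_\mu):=f(x)$ if $x\pm\eta e_\mu\notin\Omega$. Fix $a\in(0,1]$, $a_k=a\frac{1-L^{-2}}{1-L^{-2k}}$, $\bar\mu_0\ge0$, $\bar\mu_k=L^{2k}\bar\mu_0$, $G_k(\Omega)=(-\Delta^\eta_\Omega+\bar\mu_k+a_kQ^*_{\Omega,k}Q_{\Omega,k})^{-1}$.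 The kernel is $(G_k(\Omega)Q^*_{\Omega,k})(x,y)=(G_k(\Omega)Q^*_{\Omega,k}\mathbb 1_{\{y\}})(x)$ with $\mathbb 1_{\{y\}}$ the indicator of $y$ on $\Omega_k$. *)

theory Defs
  imports "HOL-Analysis.Analysis"
begin

text \<open>Lattice spacing eta = L^(-k). Points of the fine lattice and of the
block lattice are represented as vectors in real^'d, where the finite type 'd
indexes the d coordinate directions (so d = CARD('d) >= 1).\<close>

definition eta :: "nat \<Rightarrow> nat \<Rightarrow> real" where
  "eta L k = 1 / real L ^ k"

definition Omega :: "nat \<Rightarrow> nat \<Rightarrow> nat \<Rightarrow> (real^'d) set" where
  "Omega L k m = {x. \<forall>\<mu>. \<exists>n::nat. n < L ^ m \<and> x $ \<mu> = eta L k * real n}"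

definition Omegak :: "nat \<Rightarrow> nat \<Rightarrow> nat \<Rightarrow> (real^'d) set" where
  "Omegak L k m = {y. \<forall>\<mu>. \<exists>n::nat. n < L ^ (m - k) \<and> y $ \<mu> = real n}"

definition Block :: "nat \<Rightarrow> nat \<Rightarrow> real^'d \<Rightarrow> (real^'d) set" where
  "Block L k y = {x. \<forall>\<mu>. x $ \<mu> / eta L k \<in> \<int> \<and> y $ \<mu> \<le> x $ \<mu> \<and> x $ \<mu> < y $ \<mu> + 1}"

definition Qop :: "nat \<Rightarrow> nat \<Rightarrow> (real^'d \<Rightarrow> real) \<Rightarrow> real^'d \<Rightarrow> real" where
  "Qop L k f y = (1 / real L ^ (k * CARD('d))) * (\<Sum>x\<in>Block L k y. f x)"

text \<open>(Q^* h)(x) = h(y_x) where x in B_k(y_x), i.e. y_x is the componentwise floor of x.\<close>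
definition Qadj :: "(real^'d \<Rightarrow> real) \<Rightarrow> real^'d \<Rightarrow> real" where
  "Qadj h x = h (\<chi> \<mu>. real_of_int \<lfloor>x $ \<mu>\<rfloor>)"

definition nbval :: "nat \<Rightarrow> nat \<Rightarrow> nat \<Rightarrow> (real^'d \<Rightarrow> real) \<Rightarrow> real^'d \<Rightarrow> real^'d \<Rightarrow> real" where
  "nbval L k m f x p = (if p \<in> Omega L k m then f p else f x)"

definition NeumannLap :: "nat \<Rightarrow> nat \<Rightarrow> nat \<Rightarrow> (real^'d \<Rightarrow> real) \<Rightarrow> real^'d \<Rightarrow> real" where
  "NeumannLap L k m f x = (1 / (eta L k)\<^sup>2) *
     (\<Sum>\<mu>\<in>(UNIV::'d set). nbval L k m f x (x + eta L k *\<^sub>R axis \<mu> 1)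
        - 2 * f x + nbval L k m f x (x - eta L k *\<^sub>R axis \<mu> 1))"

definition a_k :: "real \<Rightarrow> nat \<Rightarrow> nat \<Rightarrow> real" where
  "a_k a L k = a * (1 - real L powi (-2)) / (1 - real L powi (- 2 * int k))"

definition mubar :: "real \<Rightarrow> nat \<Rightarrow> nat \<Rightarrow> real" where
  "mubar \<mu>0 L k = real L ^ (2 * k) * \<mu>0"

definition Hop :: "real \<Rightarrow> real \<Rightarrow> nat \<Rightarrow> nat \<Rightarrow> nat \<Rightarrow> (real^'d \<Rightarrow> real) \<Rightarrow> real^'d \<Rightarrow> real" where
  "Hop a \<mu>0 L k m f x = - NeumannLap L k m f x + mubar \<mu>0 L k * f x
      + a_k a L k * Qadj (Qop L k f) x"

definition Gk :: "real \<Rightarrow> real \<Rightarrow> nat \<Rightarrow> nat \<Rightarrow> nat \<Rightarrow> (real^'d \<Rightarrow> real) \<Rightarrow> real^'d \<Rightarrow> real" where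
  "Gk a \<mu>0 L k m f = (THE g. (\<forall>x. x \<notin> Omega L k m \<longrightarrow> g x = 0) \<and>
                          (\<forall>x\<in>Omega L k m. Hop a \<mu>0 L k m g x = f x))"

definition GQkernel :: "real \<Rightarrow> real \<Rightarrow> nat \<Rightarrow> nat \<Rightarrow> nat \<Rightarrow> real^'d \<Rightarrow> real^'d \<Rightarrow> real" where
  "GQkernel a \<mu>0 L k m x y = Gk a \<mu>0 L k m (Qadj (indicator {y})) x"

end

(*
An L^2 bound comes from the Combes-Thomas method: conjugation by exp(theta), theta a small multiple of
|x - y|_1, perturbs the quadratic form of H = -Delta + mu + a_k Q^* Q only to second order, and the
form itself is bounded below by the Poincare inequality on unit blocks.

To pass to a pointwise bound, u = G Q^* 1_y satisfies (-Delta + mu) u = Q^* (1_y - a_k Q u), whose right-hand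
side is controlled pointwise because block means are controlled by L^2 norms. By Kato's inequality |u| is
a subsolution of the lazy Neumann random walk with exponentially decaying source. Iterating L^(2k) times a
constant, the walk is ultracontractive with constant L^(-kd) (Nash's argument, again from the Poincare
inequality, now over all dyadic scales), so Cauchy-Schwarz turns the weighted L^2 bound into a pointwise
one; the exponential weights survive since products of hyperbolic cosines are supersolutions.
*)
theory Submission
  imports Defs
begin

subsection \<open>The integer grid and its Dirichlet form\<close>

text \<open>With \<open>b = L ^ k\<close>, uniformity in k, m and L means that all powers of
  \<open>b\<close> must cancel. The weighted square sum is at most a constant times
  \<open>b ^ d\<close>, the volume of the source block; reading off a point value from it directly
  would lose \<open>b ^ (d / 2)\<close>. A walk of order \<open>b ^ 2\<close> steps spreads mass
  over about \<open>b ^ d\<close> points and removes exactly this loss. Over the same time the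
  sources, of weight \<open>1 / b ^ 2\<close> per step, add up to a constant, and an exponential
  weight of rate \<open>s\<close> of order \<open>1 / b\<close> is distorted only by
  \<open>exp\<close> of a multiple of \<open>b ^ 2 * s ^ 2\<close>, which is bounded. The mass has
  no bound uniform in k, so it may enter only through its sign, both in the quadratic form and in
  Kato's inequality. The side \<open>L ^ m\<close> is odd, so dyadic cubes do not tile the grid. The
  Poincare inequality is therefore set up for tiles whose sides lie between \<open>R\<close> and
  \<open>2 * R\<close>; for \<open>R = b\<close> the same tiles are exactly the unit blocks.\<close>

definition cells :: "('d \<Rightarrow> int set) \<Rightarrow> ('d \<Rightarrow> int) set" where
  "cells I = {x. \<forall>\<nu>. x \<nu> \<in> I \<nu>}"

definition grid :: "int \<Rightarrow> ('d \<Rightarrow> int) set" where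
  "grid M = cells (\<lambda>_. {0..<M})"

definition up :: "'d \<Rightarrow> ('d \<Rightarrow> int) \<Rightarrow> 'd \<Rightarrow> int" where
  "up \<mu> x = x(\<mu> := x \<mu> + 1)"

definition dn :: "'d \<Rightarrow> ('d \<Rightarrow> int) \<Rightarrow> 'd \<Rightarrow> int" where
  "dn \<mu> x = x(\<mu> := x \<mu> - 1)"

lemma up_dn [simp]: "up \<mu> (dn \<mu> x) = x" "dn \<mu> (up \<mu> x) = x"
  by (auto simp: up_def dn_def)

definition nb :: "int \<Rightarrow> (('d \<Rightarrow> int) \<Rightarrow> real) \<Rightarrow> ('d \<Rightarrow> int) \<Rightarrow> ('d \<Rightarrow> int) \<Rightarrow> real" where
  "nb M f x z = (if z \<in> grid M then f z else f x)"

text \<open>In integer coordinates the Neumann Laplacian is \<open>- b\<^sup>2 * lap\<close> with \<open>b = L ^ k\<close>.\<close>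

definition lap :: "int \<Rightarrow> (('d::finite \<Rightarrow> int) \<Rightarrow> real) \<Rightarrow> ('d \<Rightarrow> int) \<Rightarrow> real" where
  "lap M f x = (\<Sum>\<mu>\<in>UNIV. (f x - nb M f x (up \<mu> x)) + (f x - nb M f x (dn \<mu> x)))"

text \<open>An edge is recorded by its lower endpoint, so each nearest-neighbour pair of the grid
  occurs once.\<close>

definition edges :: "int \<Rightarrow> 'd \<Rightarrow> ('d \<Rightarrow> int) set" where
  "edges M \<mu> = {x \<in> grid M. up \<mu> x \<in> grid M}"

definition dirichlet :: "int \<Rightarrow> (('d::finite \<Rightarrow> int) \<Rightarrow> real) \<Rightarrow> (('d \<Rightarrow> int) \<Rightarrow> real) \<Rightarrow> real" where
  "dirichlet M f g = (\<Sum>\<mu>\<in>UNIV. \<Sum>x\<in>edges M \<mu>. (f x - f (up \<mu> x)) * (g x - g (up \<mu> x)))"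

section \<open>Boxes and sums over edges\<close>

lemma cells_PiE: "cells I = PiE UNIV I"
  by (auto simp: cells_def)

lemma finite_cells: "(\<And>\<nu>. finite (I \<nu>)) \<Longrightarrow> finite (cells (I :: 'd::finite \<Rightarrow> int set))"
  unfolding cells_PiE by (rule finite_PiE) auto

lemma card_cells: "card (cells (I :: 'd::finite \<Rightarrow> int set)) = (\<Prod>\<nu>\<in>UNIV. card (I \<nu>))"
  unfolding cells_PiE by (rule card_PiE) auto

lemma finite_grid [simp]: "finite (grid M :: ('d::finite \<Rightarrow> int) set)"
  unfolding grid_def by (rule finite_cells) auto

lemma finite_edges [simp]: "finite (edges M \<mu> :: ('d::finite \<Rightarrow> int) set)"
  unfolding edges_def by auto

lemma sum_edges_up:
  fixes g :: "('d::finite \<Rightarrow> int) \<Rightarrow> real"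
  shows "(\<Sum>x\<in>edges M \<mu>. g (up \<mu> x)) = (\<Sum>x\<in>{x\<in>grid M. dn \<mu> x \<in> grid M}. g x)"
  by (rule sum.reindex_bij_witness[of _ "dn \<mu>" "up \<mu>"]) (auto simp: edges_def)

lemma sum_edges_up_le:
  fixes g :: "('d::finite \<Rightarrow> int) \<Rightarrow> real"
  assumes "\<And>x. x \<in> grid M \<Longrightarrow> 0 \<le> g x"
  shows "(\<Sum>x\<in>edges M \<mu>. g (up \<mu> x)) \<le> (\<Sum>x\<in>grid M. g x)"
  unfolding sum_edges_up using assms by (intro sum_mono2) auto

lemma sum_edges_le:
  fixes g :: "('d::finite \<Rightarrow> int) \<Rightarrow> real"
  assumes "\<And>x. x \<in> grid M \<Longrightarrow> 0 \<le> g x"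
  shows "(\<Sum>x\<in>edges M \<mu>. g x) \<le> (\<Sum>x\<in>grid M. g x)"
  using assms by (intro sum_mono2) (auto simp: edges_def)

text \<open>Green's formula. The Neumann convention makes differences across the boundary vanish, so
  no boundary term appears; the downward differences are reindexed by \<open>up\<close> onto the
  same edges as the upward ones.\<close>

lemma sum_mult_lap:
  fixes f g :: "('d::finite \<Rightarrow> int) \<Rightarrow> real"
  shows "(\<Sum>x\<in>grid M. g x * lap M f x) = dirichlet M f g"
proof -
  have 1: "(\<Sum>x\<in>grid M. g x * (f x - nb M f x (up \<mu> x))) = (\<Sum>x\<in>edges M \<mu>. g x * (f x - f (up \<mu> x)))" for \<mu>
    by (rule sum.mono_neutral_cong_right) (auto simp: edges_def nb_def)
  have "(\<Sum>x\<in>grid M. g x * (f x - nb M f x (dn \<mu> x)))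
      = (\<Sum>x\<in>{x\<in>grid M. dn \<mu> x \<in> grid M}. g x * (f x - f (dn \<mu> x)))" for \<mu>
    by (rule sum.mono_neutral_cong_right) (auto simp: nb_def)
  then have 2: "(\<Sum>x\<in>grid M. g x * (f x - nb M f x (dn \<mu> x)))
      = (\<Sum>x\<in>edges M \<mu>. g (up \<mu> x) * (f (up \<mu> x) - f x))" for \<mu>
    using sum_edges_up[where \<mu> = \<mu> and g = "\<lambda>x. g x * (f x - f (dn \<mu> x))"] by simp
  have "(\<Sum>x\<in>grid M. g x * lap M f x)
      = (\<Sum>\<mu>\<in>UNIV. (\<Sum>x\<in>grid M. g x * (f x - nb M f x (up \<mu> x)))
         + (\<Sum>x\<in>grid M. g x * (f x - nb M f x (dn \<mu> x))))"
    unfolding lap_def sum_distrib_left distrib_left by (subst sum.swap) (simp only: sum.distrib)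
  also have "\<dots> = dirichlet M f g"
    unfolding 1 2 dirichlet_def sum.distrib[symmetric]
    by (intro sum.cong refl) (simp add: algebra_simps)
  finally show ?thesis .
qed

lemma dirichlet_commute: "dirichlet M f g = dirichlet M g f"
  by (simp add: dirichlet_def mult.commute)

subsection \<open>Poincare inequalities\<close>

text \<open>Telescoping and Cauchy-Schwarz. Extending the sum to the whole interval makes the bound
  independent of \<open>i\<close> and \<open>j\<close>.\<close>

lemma sum_sq_diff_int:
  fixes F :: "int \<Rightarrow> real"
  assumes "l \<le> i" "i < h" "l \<le> j" "j < h"
  shows "(F i - F j)\<^sup>2 \<le> of_int (h - l) * (\<Sum>s\<in>{l..<h-1}. (F s - F (s+1))\<^sup>2)"
  using assms
proof (induction i j rule: linorder_wlog)
  case (sym a b)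
  then show ?case by (simp add: power2_commute)
next
  case (le i j)
  have tel: "F i - F (i + int n) = (\<Sum>s\<in>{i..<i + int n}. F s - F (s+1))" for n
  proof (induction n)
    case (Suc n)
    have "{i..<i + int (Suc n)} = insert (i + int n) {i..<i + int n}" by auto
    then show ?case using Suc by (simp add: ac_simps)
  qed simp
  have "(F i - F j)\<^sup>2 = (\<Sum>s\<in>{i..<j}. F s - F (s+1))\<^sup>2"
    using tel[of "nat (j - i)"] le by simp
  also have "\<dots> \<le> (\<Sum>s\<in>{i..<j}. (F s - F (s+1))\<^sup>2) * card {i..<j}"
    by (rule sum_squared_le_sum_of_squares)
  also have "\<dots> \<le> (\<Sum>s\<in>{l..<h-1}. (F s - F (s+1))\<^sup>2) * of_int (h - l)"
    using le by (intro mult_mono sum_mono2 sum_nonneg) auto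
  finally show ?case by (simp add: mult.commute)
qed

definition override :: "'d set \<Rightarrow> ('d \<Rightarrow> int) \<Rightarrow> ('d \<Rightarrow> int) \<Rightarrow> 'd \<Rightarrow> int" where
  "override S x y = (\<lambda>\<nu>. if \<nu> \<in> S then y \<nu> else x \<nu>)"

text \<open>Passing from \<open>x\<close> to \<open>y\<close> one coordinate at a time costs one single-coordinate term per
  direction, because exchanging the coordinates in \<open>S\<close> permutes the pairs of points of a product set.\<close>

lemma sum_sq_diff_override:
  fixes f :: "('d::finite \<Rightarrow> int) \<Rightarrow> real" and I :: "'d \<Rightarrow> int set"
  shows "(\<Sum>(x,y)\<in>cells I \<times> cells I. (f x - f (override S x y))\<^sup>2)
    \<le> 2 ^ card S * (\<Sum>\<mu>\<in>S. \<Sum>(x,y)\<in>cells I \<times> cells I. (f x - f (x(\<mu> := y \<mu>)))\<^sup>2)"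
proof (induction S rule: finite_induct[OF finite])
  case 1
  then show ?case by (simp add: override_def)
next
  case (2 \<mu> S)
  let ?C = "cells I" 
  let ?E = "\<lambda>\<mu>. \<Sum>(x,y)\<in>?C \<times> ?C. (f x - f (x(\<mu> := y \<mu>)))\<^sup>2"
  let ?sw = "\<lambda>(x,y). (override S x y, override S y x)"
  have inv1: "override S (override S x y) (override S y x) = x" for x y
    by (auto simp: override_def)
  have inv2: "override (insert \<mu> S) (override S x y) (override S y x) = x(\<mu> := y \<mu>)" for x y
    using \<open>\<mu> \<notin> S\<close> by (auto simp: override_def)
  have E: "?E \<mu> = (\<Sum>(x,y)\<in>?C \<times> ?C. (f (override S x y) - f (override (insert \<mu> S) x y))\<^sup>2)"
    by (rule sum.reindex_bij_witness[of _ ?sw ?sw])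
       (auto simp: inv1 inv2, auto simp: override_def cells_def)
  have Epos: "0 \<le> ?E \<nu>" for \<nu> by (intro sum_nonneg) auto
  \<comment> \<open>Each new direction costs a factor 2 from
    \<open>(a + b)^2 \<le> 2 * a^2 + 2 * b^2\<close>, which accumulates to
    \<open>2 ^ card S\<close>.\<close>
  have "(\<Sum>(x,y)\<in>?C \<times> ?C. (f x - f (override (insert \<mu> S) x y))\<^sup>2)
     \<le> (\<Sum>(x,y)\<in>?C \<times> ?C. 2 * (f x - f (override S x y))\<^sup>2
          + 2 * (f (override S x y) - f (override (insert \<mu> S) x y))\<^sup>2)"
  proof (rule sum_mono, clarify)
    fix x y
    have "(a + b)\<^sup>2 \<le> 2 * a\<^sup>2 + 2 * b\<^sup>2" for a b :: real
      using zero_le_power2[of "a - b"] by (simp add: power2_sum power2_diff)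
    from this[of "f x - f (override S x y)" "f (override S x y) - f (override (insert \<mu> S) x y)"]
    show "(f x - f (override (insert \<mu> S) x y))\<^sup>2 \<le> 2 * (f x - f (override S x y))\<^sup>2
          + 2 * (f (override S x y) - f (override (insert \<mu> S) x y))\<^sup>2" by simp
  qed
  also have "\<dots> = 2 * (\<Sum>(x,y)\<in>?C \<times> ?C. (f x - f (override S x y))\<^sup>2) + 2 * ?E \<mu>"
    unfolding E by (simp add: case_prod_unfold sum.distrib sum_distrib_left)
  also have "\<dots> \<le> 2 * (2 ^ card S * (\<Sum>\<mu>\<in>S. ?E \<mu>)) + 2 * 2 ^ card S * ?E \<mu>"
    by (intro add_mono mult_left_mono[OF 2(3)] mult_right_mono[OF _ Epos]) auto
  also have "\<dots> = 2 ^ card (insert \<mu> S) * (\<Sum>\<mu>\<in>insert \<mu> S. ?E \<mu>)"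
    using 2 by (simp add: algebra_simps)
  finally show ?case .
qed

text \<open>One factor \<open>r\<close> comes from the one-dimensional bound along the line through
  \<open>x\<close>, the other from the base points \<open>x\<close> sharing that line;
  \<open>card C\<close> counts the points \<open>y\<close>, on which the bound no longer
  depends.\<close>

lemma sum_sq_diff_coordinate:
  fixes f :: "('d::finite \<Rightarrow> int) \<Rightarrow> real" and l h :: "'d \<Rightarrow> int"
  assumes len: "of_int (h \<mu> - l \<mu>) \<le> r" and ne: "l \<mu> \<le> h \<mu>"
  defines "C \<equiv> cells (\<lambda>\<nu>. {l \<nu>..<h \<nu>})"
  shows "(\<Sum>(x,y)\<in>C \<times> C. (f x - f (x(\<mu> := y \<mu>)))\<^sup>2)
    \<le> real (card C) * r\<^sup>2 * (\<Sum>x\<in>{x\<in>C. up \<mu> x \<in> C}. (f x - f (up \<mu> x))\<^sup>2)"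
proof -
  let ?I = "{l \<mu>..<h \<mu> - 1}"
  let ?g = "\<lambda>x. (f x - f (up \<mu> x))\<^sup>2"
  have fin: "finite C" unfolding C_def by (rule finite_cells) auto
  have l0: "0 \<le> r" using len ne by linarith
  \<comment> \<open>The self-inverse map from \<open>(x, s)\<close> to
    \<open>(x(\<mu> := s), x \<mu>)\<close> moves the base point onto the edge at \<open>s\<close>
    and keeps the old coordinate as a free label.\<close>
  have sw: "(\<Sum>(x,s)\<in>C \<times> ?I. ?g (x(\<mu> := s))) = (\<Sum>(x,s)\<in>{x\<in>C. up \<mu> x \<in> C} \<times> {l \<mu>..<h \<mu>}. ?g x)"
    by (rule sum.reindex_bij_witness[of _ "\<lambda>(x,s). (x(\<mu> := s), x \<mu>)" "\<lambda>(x,s). (x(\<mu> := s), x \<mu>)"])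
       (auto simp: C_def cells_def up_def split: if_splits)
  have "(\<Sum>(x,y)\<in>C \<times> C. (f x - f (x(\<mu> := y \<mu>)))\<^sup>2) \<le> (\<Sum>(x,y)\<in>C \<times> C. r * (\<Sum>s\<in>?I. ?g (x(\<mu> := s))))"
  proof (rule sum_mono, clarify)
    fix x y assume "x \<in> C" "y \<in> C"
    then have "(f (x(\<mu> := x \<mu>)) - f (x(\<mu> := y \<mu>)))\<^sup>2
      \<le> of_int (h \<mu> - l \<mu>) * (\<Sum>s\<in>?I. (f (x(\<mu> := s)) - f (x(\<mu> := s + 1)))\<^sup>2)"
      by (intro sum_sq_diff_int[where F = "\<lambda>s. f (x(\<mu> := s))"]) (auto simp: C_def cells_def)
    also have "\<dots> \<le> r * (\<Sum>s\<in>?I. (f (x(\<mu> := s)) - f (x(\<mu> := s + 1)))\<^sup>2)"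
      using len by (intro mult_right_mono sum_nonneg) auto
    finally show "(f x - f (x(\<mu> := y \<mu>)))\<^sup>2 \<le> r * (\<Sum>s\<in>?I. ?g (x(\<mu> := s)))"
      by (simp add: up_def)
  qed
  also have "\<dots> = card C * r * (\<Sum>(x,s)\<in>C \<times> ?I. ?g (x(\<mu> := s)))"
    by (simp add: sum.cartesian_product[symmetric] sum_distrib_left mult_ac)
  also have "\<dots> = card C * r * (of_int (h \<mu> - l \<mu>) * (\<Sum>x\<in>{x\<in>C. up \<mu> x \<in> C}. ?g x))"
    unfolding sw using ne by (simp add: sum.cartesian_product[symmetric] sum_distrib_left)
  also have "\<dots> \<le> card C * r * (r * (\<Sum>x\<in>{x\<in>C. up \<mu> x \<in> C}. ?g x))"
    using len l0 by (intro mult_left_mono mult_right_mono sum_nonneg) auto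
  finally show ?thesis by (simp add: power2_eq_square mult_ac)
qed

lemma variance_identity:
  fixes f :: "'a \<Rightarrow> real"
  assumes "finite C"
  shows "(\<Sum>x\<in>C. \<Sum>y\<in>C. (f x - f y)\<^sup>2) = 2 * card C * (\<Sum>x\<in>C. (f x)\<^sup>2) - 2 * (\<Sum>x\<in>C. f x)\<^sup>2"
  by (simp add: power2_diff sum.distrib sum_subtractf sum_distrib_left sum_distrib_right
      power2_eq_square sum_product algebra_simps)

text \<open>Pairwise differences sum to \<open>2 * card C\<close> times the centred square sum, and
  \<open>override UNIV x y = y\<close> lets the coordinatewise path bound apply to them.\<close>

lemma poincare_cell:
  fixes f :: "('d::finite \<Rightarrow> int) \<Rightarrow> real" and l h :: "'d \<Rightarrow> int"
  assumes len: "\<And>\<nu>. of_int (h \<nu> - l \<nu>) \<le> r" and ne: "\<And>\<nu>. l \<nu> < h \<nu>"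
  defines "C \<equiv> cells (\<lambda>\<nu>. {l \<nu>..<h \<nu>})"
  shows "(\<Sum>x\<in>C. (f x)\<^sup>2) \<le> 2 ^ CARD('d) * r\<^sup>2 * (\<Sum>\<mu>\<in>UNIV. \<Sum>x\<in>{x\<in>C. up \<mu> x \<in> C}. (f x - f (up \<mu> x))\<^sup>2)
      + (\<Sum>x\<in>C. f x)\<^sup>2 / card C"
proof -
  have fin: "finite C" unfolding C_def by (rule finite_cells) auto
  have "l \<in> C" using ne by (auto simp: C_def cells_def)
  then have pos: "0 < real (card C)" using fin by (simp add: card_gt_0_iff) blast
  define E where "E = (\<Sum>\<mu>\<in>UNIV. \<Sum>x\<in>{x\<in>C. up \<mu> x \<in> C}. (f x - f (up \<mu> x))\<^sup>2)"
  have E0: "0 \<le> E" unfolding E_def by (intro sum_nonneg) auto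
  have "(\<Sum>x\<in>C. \<Sum>y\<in>C. (f x - f y)\<^sup>2) = (\<Sum>(x,y)\<in>C \<times> C. (f x - f (override UNIV x y))\<^sup>2)"
    by (simp add: override_def sum.cartesian_product)
  also have "\<dots> \<le> 2 ^ CARD('d) * (\<Sum>\<mu>\<in>UNIV. \<Sum>(x,y)\<in>C \<times> C. (f x - f (x(\<mu> := y \<mu>)))\<^sup>2)"
    unfolding C_def by (rule sum_sq_diff_override)
  also have "\<dots> \<le> 2 ^ CARD('d) * (\<Sum>\<mu>\<in>UNIV. card C * r\<^sup>2 * (\<Sum>x\<in>{x\<in>C. up \<mu> x \<in> C}. (f x - f (up \<mu> x))\<^sup>2))"
    unfolding C_def using len ne
    by (intro mult_left_mono sum_mono sum_sq_diff_coordinate) (auto intro: less_imp_le)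
  also have "\<dots> = card C * (2 ^ CARD('d) * r\<^sup>2 * E)"
    by (simp add: E_def sum_distrib_left mult_ac)
  finally have "2 * card C * (\<Sum>x\<in>C. (f x)\<^sup>2) - 2 * (\<Sum>x\<in>C. f x)\<^sup>2 \<le> card C * (2 ^ CARD('d) * r\<^sup>2 * E)"
    unfolding variance_identity[OF fin] .
  also have "\<dots> \<le> card C * (2 ^ CARD('d) * r\<^sup>2 * E) * 2" using E0 by simp
  finally show ?thesis unfolding E_def[symmetric] using pos by (simp add: field_simps)
qed

text \<open>\<open>{0..<M}\<close> is cut into intervals of length at least \<open>R\<close> and less than \<open>2 R\<close>: the remainder of the
  division of \<open>M\<close> by \<open>R\<close> is added to the last interval.\<close>

definition coarse :: "int \<Rightarrow> int \<Rightarrow> int \<Rightarrow> int" where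
  "coarse R M n = min (n div R) (M div R - 1)"

definition tile :: "int \<Rightarrow> int \<Rightarrow> ('d \<Rightarrow> int) \<Rightarrow> ('d \<Rightarrow> int) set" where
  "tile R M \<kappa> = {x \<in> grid M. (\<lambda>\<nu>. coarse R M (x \<nu>)) = \<kappa>}"

lemma coarse_eq_iff:
  assumes R: "0 < R" "R \<le> M" and j: "0 \<le> j" "j < M div R"
  shows "0 \<le> n \<and> n < M \<and> coarse R M n = j \<longleftrightarrow> j * R \<le> n \<and> n < (if j = M div R - 1 then M else (j + 1) * R)"
proof -
  have MR: "M div R * R \<le> M" 
    using R by (simp add: minus_mod_eq_div_mult[symmetric])
  \<comment> \<open>This Galois property of \<open>div\<close> locates both ends of the fibre of
    \<open>coarse\<close>; the last fibre has its upper end at \<open>M\<close>.\<close>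
  have q: "q \<le> n div R \<longleftrightarrow> q * R \<le> n" for q
  proof
    assume "q \<le> n div R"
    then have "q * R \<le> n div R * R" using R by (intro mult_right_mono) auto
    also have "\<dots> \<le> n" using R by (simp add: minus_mod_eq_div_mult[symmetric])
    finally show "q * R \<le> n" .
  next
    assume "q * R \<le> n"
    then have "q * R div R \<le> n div R" using R by (intro zdiv_mono1) auto
    then show "q \<le> n div R" using R by simp
  qed
  show ?thesis
  proof (cases "j = M div R - 1")
    case True
    have "0 \<le> j * R" using j R by simp
    then show ?thesis using True q[of j] by (auto simp: coarse_def min_def)
  next
    case False
    then have "j + 1 \<le> M div R - 1" using j by simp
    then have "(j + 1) * R \<le> (M div R - 1) * R" using R by (intro mult_right_mono) auto
    also have "\<dots> \<le> M" using MR R by (simp add: algebra_simps)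
    finally have "(j + 1) * R \<le> M" .
    moreover have "0 \<le> j * R" using j R by simp
    moreover have "coarse R M n = j \<longleftrightarrow> n div R = j" using False j by (auto simp: coarse_def min_def)
    moreover have "n div R = j \<longleftrightarrow> j * R \<le> n \<and> n < (j + 1) * R" using q[of j] q[of "j+1"] by auto
    ultimately show ?thesis using False by auto
  qed
qed

lemma tile_eq_cells:
  assumes R: "0 < R" "R \<le> M" and \<kappa>: "\<kappa> \<in> grid (M div R)"
  shows "tile R M \<kappa> = cells (\<lambda>\<nu>. {\<kappa> \<nu> * R ..< (if \<kappa> \<nu> = M div R - 1 then M else (\<kappa> \<nu> + 1) * R)})"
proof -
  have \<kappa>': "0 \<le> \<kappa> \<nu>" "\<kappa> \<nu> < M div R" for \<nu> using \<kappa> by (auto simp: grid_def cells_def)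
  show ?thesis
    unfolding tile_def cells_def grid_def fun_eq_iff mem_Collect_eq atLeastLessThan_iff
      all_conj_distrib[symmetric] coarse_eq_iff[OF R \<kappa>', symmetric] conj_assoc ..
qed

text \<open>The first two bounds serve the dyadic scales, where \<open>R\<close> need not divide
  \<open>M\<close>; the third serves the unit blocks, where it does.\<close>

lemma tile_length:
  fixes R M j :: int
  assumes R: "0 < R" "R \<le> M" and j: "0 \<le> j" "j < M div R"
  defines "h \<equiv> (if j = M div R - 1 then M else (j + 1) * R)"
  shows "R \<le> h - j * R" "h - j * R \<le> 2 * R" "R dvd M \<Longrightarrow> h - j * R = R"
proof -
  have M: "M = M div R * R + M mod R" by simp
  have m: "0 \<le> M mod R" "M mod R < R" using R by auto
  have last: "M - (M div R - 1) * R = R + M mod R" using M by (simp add: algebra_simps)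
  have "h - j * R = R + M mod R" if "j = M div R - 1"
    unfolding h_def that using last by simp
  moreover have "h - j * R = R" if "j \<noteq> M div R - 1"
    using that by (simp add: h_def algebra_simps)
  ultimately show "R \<le> h - j * R" "h - j * R \<le> 2 * R" "R dvd M \<Longrightarrow> h - j * R = R"
    using m by (cases "j = M div R - 1"; simp)+
qed

lemma finite_tile [simp]: "finite (tile R M \<kappa> :: ('d::finite \<Rightarrow> int) set)"
  by (auto simp: tile_def)

lemma card_tile_ge:
  fixes \<kappa> :: "'d::finite \<Rightarrow> int"
  assumes R: "0 < R" "R \<le> M" and \<kappa>: "\<kappa> \<in> grid (M div R)"
  shows "of_int R ^ CARD('d) \<le> real (card (tile R M \<kappa>))"
proof -
  have "of_int R ^ CARD('d) = (\<Prod>\<nu>\<in>(UNIV::'d set). real_of_int R)" by simp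
  also have "\<dots> \<le> (\<Prod>\<nu>\<in>UNIV. real (card {\<kappa> \<nu> * R ..< (if \<kappa> \<nu> = M div R - 1 then M else (\<kappa> \<nu> + 1) * R)}))"
  proof (intro prod_mono conjI)
    fix \<nu>
    have "R \<le> (if \<kappa> \<nu> = M div R - 1 then M else (\<kappa> \<nu> + 1) * R) - \<kappa> \<nu> * R"
      using \<kappa> by (intro tile_length(1)[OF R]) (auto simp: grid_def cells_def)
    then show "real_of_int R \<le> real (card {\<kappa> \<nu> * R ..< (if \<kappa> \<nu> = M div R - 1 then M else (\<kappa> \<nu> + 1) * R)})"
      unfolding card_atLeastLessThan_int by linarith
  qed (use R in auto)
  finally show ?thesis unfolding tile_eq_cells[OF R \<kappa>] card_cells of_nat_prod .
qed

lemma card_tile_eq: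
  fixes \<kappa> :: "'d::finite \<Rightarrow> int"
  assumes R: "0 < R" "R \<le> M" "R dvd M" and \<kappa>: "\<kappa> \<in> grid (M div R)"
  shows "real (card (tile R M \<kappa>)) = of_int R ^ CARD('d)"
proof -
  have "of_int R ^ CARD('d) = (\<Prod>\<nu>\<in>(UNIV::'d set). real_of_int R)" by simp
  also have "\<dots> = (\<Prod>\<nu>\<in>UNIV. real (card {\<kappa> \<nu> * R ..< (if \<kappa> \<nu> = M div R - 1 then M else (\<kappa> \<nu> + 1) * R)}))"
  proof (intro prod.cong refl)
    fix \<nu>
    have "(if \<kappa> \<nu> = M div R - 1 then M else (\<kappa> \<nu> + 1) * R) - \<kappa> \<nu> * R = R"
      using \<kappa> by (intro tile_length(3)[OF R(1,2) _ _ R(3)]) (auto simp: grid_def cells_def)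
    then show "real_of_int R = real (card {\<kappa> \<nu> * R ..< (if \<kappa> \<nu> = M div R - 1 then M else (\<kappa> \<nu> + 1) * R)})"
      unfolding card_atLeastLessThan_int using R by linarith
  qed
  finally show ?thesis unfolding tile_eq_cells[OF R(1,2) \<kappa>] card_cells of_nat_prod by simp
qed

lemma coarse_in_grid:
  assumes R: "0 < R" "R \<le> M" and x: "x \<in> grid M"
  shows "(\<lambda>\<nu>. coarse R M (x \<nu>)) \<in> grid (M div R)"
proof -
  have "1 \<le> M div R" using R by (simp add: pos_imp_zdiv_pos_iff int_one_le_iff_zero_less)
  then show ?thesis using x R by (auto simp: grid_def cells_def coarse_def min_def pos_imp_zdiv_nonneg_iff)
qed

lemma sum_tiles:
  fixes f :: "('d::finite \<Rightarrow> int) \<Rightarrow> real"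
  assumes R: "0 < R" "R \<le> M"
  shows "(\<Sum>\<kappa>\<in>grid (M div R). \<Sum>x\<in>tile R M \<kappa>. f x) = (\<Sum>x\<in>grid M. f x)"
  unfolding tile_def using coarse_in_grid[OF R] by (intro sum.group) auto

text \<open>Tile sides are at most \<open>2 * R\<close>, whence the factor 4. Each edge inside a
  tile is charged to the tile of its lower endpoint; edges between tiles only enlarge the right-hand
  side.\<close>

lemma poincare_tiles:
  fixes f :: "('d::finite \<Rightarrow> int) \<Rightarrow> real"
  assumes R: "0 < R" "R \<le> M"
  shows "(\<Sum>x\<in>grid M. (f x)\<^sup>2) \<le> 4 * 2 ^ CARD('d) * (of_int R)\<^sup>2 * dirichlet M f f
     + (\<Sum>\<kappa>\<in>grid (M div R). (\<Sum>x\<in>tile R M \<kappa>. f x)\<^sup>2 / card (tile R M \<kappa>))"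
proof -
  let ?g = "\<lambda>\<mu> x. (f x - f (up \<mu> x))\<^sup>2"
  let ?in = "\<lambda>\<kappa> \<mu>. {x \<in> tile R M \<kappa>. up \<mu> x \<in> tile R M \<kappa>}"
  have cell: "(\<Sum>x\<in>tile R M \<kappa>. (f x)\<^sup>2) \<le> 2 ^ CARD('d) * (2 * of_int R)\<^sup>2 * (\<Sum>\<mu>\<in>UNIV. \<Sum>x\<in>?in \<kappa> \<mu>. ?g \<mu> x)
      + (\<Sum>x\<in>tile R M \<kappa>. f x)\<^sup>2 / card (tile R M \<kappa>)" if \<kappa>: "\<kappa> \<in> grid (M div R)" for \<kappa>
  proof -
    have l: "R \<le> (if \<kappa> \<nu> = M div R - 1 then M else (\<kappa> \<nu> + 1) * R) - \<kappa> \<nu> * R"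
      "(if \<kappa> \<nu> = M div R - 1 then M else (\<kappa> \<nu> + 1) * R) - \<kappa> \<nu> * R \<le> 2 * R" for \<nu>
      using tile_length[OF R, of "\<kappa> \<nu>"] \<kappa> by (auto simp: grid_def cells_def)
    show ?thesis unfolding tile_eq_cells[OF R \<kappa>]
    proof (rule poincare_cell)
      fix \<nu>
      show "\<kappa> \<nu> * R < (if \<kappa> \<nu> = M div R - 1 then M else (\<kappa> \<nu> + 1) * R)" using l(1)[of \<nu>] R by linarith
      show "real_of_int ((if \<kappa> \<nu> = M div R - 1 then M else (\<kappa> \<nu> + 1) * R) - \<kappa> \<nu> * R) \<le> 2 * real_of_int R" 
        using l(2)[of \<nu>] by linarith
    qed
  qed
  have "(\<Sum>\<kappa>\<in>grid (M div R). \<Sum>\<mu>\<in>UNIV. \<Sum>x\<in>?in \<kappa> \<mu>. ?g \<mu> x)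
      \<le> (\<Sum>\<kappa>\<in>grid (M div R). \<Sum>\<mu>\<in>UNIV. \<Sum>x\<in>{x \<in> edges M \<mu>. (\<lambda>\<nu>. coarse R M (x \<nu>)) = \<kappa>}. ?g \<mu> x)"
    by (intro sum_mono sum_mono2) (auto simp: edges_def tile_def)
  also have "\<dots> = (\<Sum>\<mu>\<in>UNIV. \<Sum>\<kappa>\<in>grid (M div R). \<Sum>x\<in>{x \<in> edges M \<mu>. (\<lambda>\<nu>. coarse R M (x \<nu>)) = \<kappa>}. ?g \<mu> x)"
    by (rule sum.swap)
  also have "\<dots> = (\<Sum>\<mu>\<in>UNIV. \<Sum>x\<in>edges M \<mu>. ?g \<mu> x)"
    using coarse_in_grid[OF R] by (intro sum.cong refl sum.group) (auto simp: edges_def)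
  also have "\<dots> = dirichlet M f f" by (simp add: dirichlet_def power2_eq_square)
  finally have D: "(\<Sum>\<kappa>\<in>grid (M div R). \<Sum>\<mu>\<in>UNIV. \<Sum>x\<in>?in \<kappa> \<mu>. ?g \<mu> x) \<le> dirichlet M f f" .
  have "(\<Sum>x\<in>grid M. (f x)\<^sup>2) = (\<Sum>\<kappa>\<in>grid (M div R). \<Sum>x\<in>tile R M \<kappa>. (f x)\<^sup>2)"
    by (rule sum_tiles[OF R, symmetric])
  also have "\<dots> \<le> (\<Sum>\<kappa>\<in>grid (M div R). 2 ^ CARD('d) * (2 * of_int R)\<^sup>2 * (\<Sum>\<mu>\<in>UNIV. \<Sum>x\<in>?in \<kappa> \<mu>. ?g \<mu> x)
      + (\<Sum>x\<in>tile R M \<kappa>. f x)\<^sup>2 / card (tile R M \<kappa>))"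
    by (rule sum_mono) (rule cell)
  also have "\<dots> = 4 * 2 ^ CARD('d) * (of_int R)\<^sup>2 * (\<Sum>\<kappa>\<in>grid (M div R). \<Sum>\<mu>\<in>UNIV. \<Sum>x\<in>?in \<kappa> \<mu>. ?g \<mu> x)
     + (\<Sum>\<kappa>\<in>grid (M div R). (\<Sum>x\<in>tile R M \<kappa>. f x)\<^sup>2 / card (tile R M \<kappa>))"
    by (simp only: sum.distrib sum_distrib_left[symmetric]) (simp add: power_mult_distrib mult_ac)
  also have "\<dots> \<le> 4 * 2 ^ CARD('d) * (of_int R)\<^sup>2 * dirichlet M f f
     + (\<Sum>\<kappa>\<in>grid (M div R). (\<Sum>x\<in>tile R M \<kappa>. f x)\<^sup>2 / card (tile R M \<kappa>))"
    by (intro add_right_mono mult_left_mono D) auto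
  finally show ?thesis .
qed

text \<open>Nash's inequality before optimising over \<open>R\<close>: tiles have at least
  \<open>R ^ d\<close> points, and since the tile sums are nonnegative, their squares add up to at
  most the square of the total. The scale stays free because the dyadic iteration prescribes it at
  each stage.\<close>

lemma nash_scale:
  fixes f :: "('d::finite \<Rightarrow> int) \<Rightarrow> real"
  assumes R: "0 < R" "R \<le> M" and f0: "\<And>x. x \<in> grid M \<Longrightarrow> 0 \<le> f x"
  shows "(\<Sum>x\<in>grid M. (f x)\<^sup>2) \<le> 4 * 2 ^ CARD('d) * (of_int R)\<^sup>2 * dirichlet M f f
     + (\<Sum>x\<in>grid M. f x)\<^sup>2 / of_int R ^ CARD('d)"
proof -
  let ?s = "\<lambda>\<kappa>. \<Sum>x\<in>tile R M \<kappa>. f x"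
  let ?K = "grid (M div R) :: ('d \<Rightarrow> int) set"
  have s0: "0 \<le> ?s \<kappa>" for \<kappa> using f0 by (intro sum_nonneg) (auto simp: tile_def)
  have Rd: "0 < real_of_int R ^ CARD('d)" using R by simp
  have "(\<Sum>\<kappa>\<in>?K. (?s \<kappa>)\<^sup>2 / card (tile R M \<kappa>)) \<le> (\<Sum>\<kappa>\<in>?K. (?s \<kappa>)\<^sup>2 / of_int R ^ CARD('d))"
  proof (intro sum_mono divide_left_mono zero_le_power2)
    fix \<kappa> :: "'d \<Rightarrow> int" assume "\<kappa> \<in> ?K"
    from card_tile_ge[OF R this] show "of_int R ^ CARD('d) \<le> real (card (tile R M \<kappa>))" .
    then show "0 < real (card (tile R M \<kappa>)) * of_int R ^ CARD('d)" using Rd by (intro mult_pos_pos) linarith+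
  qed
  also have "\<dots> = (\<Sum>\<kappa>\<in>?K. (?s \<kappa>)\<^sup>2) / of_int R ^ CARD('d)" by (simp add: sum_divide_distrib)
  also have "(\<Sum>\<kappa>\<in>?K. (?s \<kappa>)\<^sup>2) \<le> (\<Sum>\<kappa>\<in>?K. ?s \<kappa> * (\<Sum>\<kappa>'\<in>?K. ?s \<kappa>'))"
    unfolding power2_eq_square using s0 
    by (intro sum_mono mult_left_mono member_le_sum) auto
  also have "\<dots> = (\<Sum>x\<in>grid M. f x)\<^sup>2"
    by (simp add: sum_distrib_right[symmetric] sum_tiles[OF R] power2_eq_square)
  finally show ?thesis using poincare_tiles[OF R, of f] Rd by (simp add: divide_right_mono)
qed

subsection \<open>Ultracontractivity of the lazy Neumann walk\<close>

text \<open>\<open>4 * d\<close> is twice the number of neighbours, so the walk holds with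
  probability at least one half. Since \<open>lap\<close> has spectrum between 0 and
  \<open>4 * d\<close>, the operator is a positive contraction and no parity oscillation can
  occur.\<close>

definition walk :: "int \<Rightarrow> (('d::finite \<Rightarrow> int) \<Rightarrow> real) \<Rightarrow> ('d \<Rightarrow> int) \<Rightarrow> real" where
  "walk M f x = f x - lap M f x / (4 * real CARD('d))"

definition dirac :: "('d \<Rightarrow> int) \<Rightarrow> ('d \<Rightarrow> int) \<Rightarrow> real" where
  "dirac x = indicator {x}"

text \<open>The weights of this average are nonnegative, which is the source of
  monotonicity.\<close>

lemma walk_eq_average:
  fixes f :: "('d::finite \<Rightarrow> int) \<Rightarrow> real"
  shows "walk M f x = (\<Sum>\<mu>\<in>UNIV. 2 * f x + nb M f x (up \<mu> x) + nb M f x (dn \<mu> x)) / (4 * real CARD('d))"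
proof -
  have "(\<Sum>\<mu>\<in>(UNIV::'d set). 2 * f x + nb M f x (up \<mu> x) + nb M f x (dn \<mu> x))
      = (\<Sum>\<mu>\<in>(UNIV::'d set). 4 * f x - ((f x - nb M f x (up \<mu> x)) + (f x - nb M f x (dn \<mu> x))))"
    by (rule sum.cong) auto
  also have "\<dots> = 4 * real CARD('d) * f x - lap M f x"
    by (simp only: sum_subtractf lap_def) simp
  finally show ?thesis by (simp add: walk_def field_simps)
qed

lemma walk_mono:
  assumes "x \<in> grid M" and "\<And>z. z \<in> grid M \<Longrightarrow> f z \<le> g z"
  shows "walk M f x \<le> walk M g x"
  unfolding walk_eq_average using assms
  by (intro divide_right_mono sum_mono add_mono mult_left_mono) (auto simp: nb_def)

lemma walk_cmult: "walk M (\<lambda>x. c * f x) x = c * walk M f x"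
proof -
  have nb: "nb M (\<lambda>x. c * f x) x z = c * nb M f x z" for z by (simp add: nb_def)
  show ?thesis unfolding walk_eq_average nb by (simp add: sum_distrib_left distrib_left mult.left_commute)
qed

lemma walk_add: "walk M (\<lambda>x. f x + g x) x = walk M f x + walk M g x"
  unfolding walk_eq_average add_divide_distrib[symmetric] sum.distrib[symmetric]
  by (intro arg_cong2[where f="(/)"] sum.cong) (auto simp: nb_def)

lemma walk_0: "walk M (\<lambda>x. 0) x = 0"
  by (simp add: walk_eq_average nb_def)

section \<open>Iterates of the walk and transition probabilities\<close>

lemma walk_iter_mono:
  assumes "x \<in> grid M" and "\<And>z. z \<in> grid M \<Longrightarrow> f z \<le> g z"
  shows "(walk M ^^ n) f x \<le> (walk M ^^ n) g x"
  using assms by (induction n arbitrary: x) (auto intro: walk_mono)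

lemma walk_iter_cmult: "(walk M ^^ n) (\<lambda>x. c * f x) = (\<lambda>x. c * (walk M ^^ n) f x)"
  by (induction n) (auto simp: walk_cmult)

lemma walk_iter_add: "(walk M ^^ n) (\<lambda>x. f x + g x) = (\<lambda>x. (walk M ^^ n) f x + (walk M ^^ n) g x)"
  by (induction n) (auto simp: walk_add)

lemma walk_iter_0: "(walk M ^^ n) (\<lambda>x. 0) = (\<lambda>x. 0)"
  by (induction n) (auto simp: walk_0)

lemma walk_iter_nonneg:
  assumes "x \<in> grid M" and "\<And>z. z \<in> grid M \<Longrightarrow> 0 \<le> f z"
  shows "0 \<le> (walk M ^^ n) f x"
  using walk_iter_mono[of x M "\<lambda>_. 0" f n] assms by (simp add: walk_iter_0)

lemma sum_walk_commute: "(\<Sum>x\<in>grid M. g x * walk M f x) = (\<Sum>x\<in>grid M. walk M g x * f x)"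
proof -
  have "(\<Sum>x\<in>grid M. g x * lap M f x) = (\<Sum>x\<in>grid M. f x * lap M g x)"
    unfolding sum_mult_lap by (rule dirichlet_commute)
  then show ?thesis
    by (simp add: walk_def right_diff_distrib left_diff_distrib sum_subtractf
        sum_divide_distrib[symmetric] mult.commute)
qed

lemma sum_walk_iter_commute:
  "(\<Sum>x\<in>grid M. g x * (walk M ^^ n) f x) = (\<Sum>x\<in>grid M. (walk M ^^ n) g x * f x)"
proof (induction n arbitrary: g)
  case (Suc n)
  have "(\<Sum>x\<in>grid M. g x * (walk M ^^ Suc n) f x) = (\<Sum>x\<in>grid M. walk M g x * (walk M ^^ n) f x)"
    by (simp add: sum_walk_commute)
  also have "\<dots> = (\<Sum>x\<in>grid M. (walk M ^^ Suc n) g x * f x)"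
    using Suc[of "walk M g"] by (simp add: funpow_swap1)
  finally show ?case .
qed simp

lemma sum_walk: "(\<Sum>x\<in>grid M. walk M f x) = (\<Sum>x\<in>grid M. f x)"
proof -
  have "(\<Sum>x\<in>grid M. lap M f x) = 0"
    using sum_mult_lap[of "\<lambda>_. 1" M f] by (simp add: dirichlet_def)
  then show ?thesis by (simp add: walk_def sum_subtractf sum_divide_distrib[symmetric])
qed

lemma sum_walk_iter: "(\<Sum>x\<in>grid M. (walk M ^^ n) f x) = (\<Sum>x\<in>grid M. f x)"
  by (induction n) (simp_all add: sum_walk)

lemma sum_dirac_mult:
  fixes x :: "'d::finite \<Rightarrow> int"
  assumes "x \<in> grid M" shows "(\<Sum>z\<in>grid M. dirac x z * f z) = f x"
  using assms by (simp add: dirac_def indicator_def of_bool_def if_distrib[of "\<lambda>t. t * _"] sum.delta cong: if_cong)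

text \<open>By self-adjointness the iterates of \<open>dirac x\<close> are the transition
  probabilities out of \<open>x\<close>.\<close>

lemma walk_iter_kernel:
  assumes "x \<in> grid M"
  shows "(walk M ^^ n) f x = (\<Sum>z\<in>grid M. (walk M ^^ n) (dirac x) z * f z)"
  using sum_walk_iter_commute[where g = "dirac x" and n = n and f = f] sum_dirac_mult[OF assms] by metis

lemma dirac_nonneg: "0 \<le> dirac x z"
  by (simp add: dirac_def)

text \<open>The transition probabilities are nonnegative weights, so each can be split into two
  square roots.\<close>

lemma walk_iter_cauchy_schwarz:
  assumes "x \<in> grid M"
  shows "((walk M ^^ n) (\<lambda>z. f z * g z) x)\<^sup>2
    \<le> (walk M ^^ n) (\<lambda>z. (f z)\<^sup>2) x * (walk M ^^ n) (\<lambda>z. (g z)\<^sup>2) x"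
proof -
  let ?q = "(walk M ^^ n) (dirac x)"
  have q: "0 \<le> ?q z" if "z \<in> grid M" for z
    using that by (intro walk_iter_nonneg) (auto simp: dirac_nonneg)
  have "(walk M ^^ n) (\<lambda>z. f z * g z) x = (\<Sum>z\<in>grid M. (sqrt (?q z) * f z) * (sqrt (?q z) * g z))"
    unfolding walk_iter_kernel[OF assms, of n "\<lambda>z. f z * g z"] using q
    by (intro sum.cong refl) (simp add: mult_ac flip: mult.assoc)
  moreover have "(walk M ^^ n) (\<lambda>z. (h z)\<^sup>2) x = (\<Sum>z\<in>grid M. (sqrt (?q z) * h z)\<^sup>2)" for h
    unfolding walk_iter_kernel[OF assms, of n "\<lambda>z. (h z)\<^sup>2"] using q
    by (intro sum.cong refl) (simp add: power_mult_distrib)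
  ultimately show ?thesis using Cauchy_Schwarz_ineq_sum[of "\<lambda>z. sqrt (?q z) * f z" "\<lambda>z. sqrt (?q z) * g z" "grid M"]
    by simp
qed

text \<open>The operator inequality \<open>lap^2 \<le> 4 * d * lap\<close>: Cauchy-Schwarz over the
  \<open>2 * d\<close> differences at a point gives \<open>2 * d\<close>, and each edge is seen from
  both of its ends.\<close>

lemma sum_lap_sq_le:
  fixes f :: "('d::finite \<Rightarrow> int) \<Rightarrow> real"
  shows "(\<Sum>x\<in>grid M. (lap M f x)\<^sup>2) \<le> 4 * real CARD('d) * dirichlet M f f"
proof -
  let ?a = "\<lambda>\<mu> x. f x - nb M f x (up \<mu> x)" and ?b = "\<lambda>\<mu> x. f x - nb M f x (dn \<mu> x)"
  have 1: "(\<Sum>x\<in>grid M. (?a \<mu> x)\<^sup>2) = (\<Sum>x\<in>edges M \<mu>. (f x - f (up \<mu> x))\<^sup>2)" for \<mu>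
    by (rule sum.mono_neutral_cong_right) (auto simp: edges_def nb_def)
  have "(\<Sum>x\<in>grid M. (?b \<mu> x)\<^sup>2) = (\<Sum>x\<in>{x\<in>grid M. dn \<mu> x \<in> grid M}. (f x - f (dn \<mu> x))\<^sup>2)" for \<mu>
    by (rule sum.mono_neutral_cong_right) (auto simp: nb_def)
  then have 2: "(\<Sum>x\<in>grid M. (?b \<mu> x)\<^sup>2) = (\<Sum>x\<in>edges M \<mu>. (f x - f (up \<mu> x))\<^sup>2)" for \<mu>
    using sum_edges_up[where \<mu> = \<mu> and g = "\<lambda>x. (f x - f (dn \<mu> x))\<^sup>2"] by (simp add: power2_commute)
  have pt: "(lap M f x)\<^sup>2 \<le> 2 * real CARD('d) * (\<Sum>\<mu>\<in>UNIV. (?a \<mu> x)\<^sup>2 + (?b \<mu> x)\<^sup>2)" for x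
  proof -
    have ab: "(a + b)\<^sup>2 \<le> 2 * (a\<^sup>2 + b\<^sup>2)" for a b :: real
      using zero_le_power2[of "a - b"] by (simp add: power2_sum power2_diff)
    have "(lap M f x)\<^sup>2 \<le> (\<Sum>\<mu>\<in>UNIV. (?a \<mu> x + ?b \<mu> x)\<^sup>2) * real CARD('d)"
      unfolding lap_def by (rule sum_squared_le_sum_of_squares)
    also have "\<dots> \<le> (\<Sum>\<mu>\<in>UNIV. 2 * ((?a \<mu> x)\<^sup>2 + (?b \<mu> x)\<^sup>2)) * real CARD('d)"
      by (intro mult_right_mono sum_mono ab) auto
    finally show ?thesis by (simp only: sum_distrib_left[symmetric] mult_ac)
  qed
  have "(\<Sum>x\<in>grid M. (lap M f x)\<^sup>2)
     \<le> (\<Sum>x\<in>grid M. 2 * real CARD('d) * (\<Sum>\<mu>\<in>UNIV. (?a \<mu> x)\<^sup>2 + (?b \<mu> x)\<^sup>2))"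
    by (rule sum_mono) (rule pt)
  also have "\<dots> = 2 * real CARD('d) * (\<Sum>\<mu>\<in>UNIV. \<Sum>x\<in>grid M. (?a \<mu> x)\<^sup>2 + (?b \<mu> x)\<^sup>2)"
    by (simp only: sum_distrib_left[symmetric] sum.swap[of _ UNIV])
  also have "\<dots> = 2 * real CARD('d) * (\<Sum>\<mu>\<in>UNIV. 2 * (\<Sum>x\<in>edges M \<mu>. (f x - f (up \<mu> x))\<^sup>2))"
    unfolding sum.distrib[of "\<lambda>x. (?a _ x)\<^sup>2"] 1 2 by simp
  finally show ?thesis
    by (simp only: sum_distrib_left[symmetric]) (simp add: dirichlet_def power2_eq_square)
qed

lemma sum_walk_sq_le:
  fixes f :: "('d::finite \<Rightarrow> int) \<Rightarrow> real"
  shows "(\<Sum>x\<in>grid M. (walk M f x)\<^sup>2) \<le> (\<Sum>x\<in>grid M. (f x)\<^sup>2) - dirichlet M f f / (4 * real CARD('d))"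
proof -
  define c where "c = 4 * real CARD('d)"
  have c: "0 < c" by (simp add: c_def)
  have "(\<Sum>x\<in>grid M. (walk M f x)\<^sup>2)
      = (\<Sum>x\<in>grid M. (f x)\<^sup>2 - 2 / c * (f x * lap M f x) + (lap M f x)\<^sup>2 / c\<^sup>2)"
    by (intro sum.cong refl) (simp add: walk_def power2_diff c_def[symmetric] power_divide)
  also have "\<dots> = (\<Sum>x\<in>grid M. (f x)\<^sup>2) - 2 / c * dirichlet M f f + (\<Sum>x\<in>grid M. (lap M f x)\<^sup>2) / c\<^sup>2"
    by (simp only: sum.distrib sum_subtractf sum_distrib_left[symmetric] sum_divide_distrib[symmetric] sum_mult_lap)
  \<comment> \<open>With the normalisation \<open>c = 4 * d\<close> the quadratic term uses up
    exactly half of the linear one.\<close>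
  also have "\<dots> \<le> (\<Sum>x\<in>grid M. (f x)\<^sup>2) - 2 / c * dirichlet M f f + c * dirichlet M f f / c\<^sup>2"
    using sum_lap_sq_le[of M f] by (intro add_left_mono divide_right_mono) (auto simp: c_def)
  also have "\<dots> = (\<Sum>x\<in>grid M. (f x)\<^sup>2) - dirichlet M f f / c"
    using c by (simp add: field_simps power2_eq_square)
  finally show ?thesis unfolding c_def .
qed

text \<open>At scale \<open>R\<close>, the excess of \<open>\<Sum> f\<^sup>2\<close> over \<open>1 / R ^ d\<close> contracts by a factor \<open>1 - 1 / (16 d 2^d R\<^sup>2)\<close>
  per step, so \<open>mixing d * R\<^sup>2\<close> steps contract it by \<open>exp (- d - 1)\<close>, enough to absorb a doubling of \<open>R\<close>.\<close>

definition mixing :: "nat \<Rightarrow> nat" where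
  "mixing d = 16 * d * 2 ^ d * (d + 1)"

text \<open>\<open>nash_scale\<close> bounds the Dirichlet form below by the excess over
  \<open>4 * 2^d * R^2\<close>, and one step dissipates that form over \<open>4 * d\<close>;
  \<epsilon> combines the two constants. The excess may have either sign.\<close>

lemma return_prob_step:
  fixes f :: "('d::finite \<Rightarrow> int) \<Rightarrow> real"
  assumes R: "0 < R" "R \<le> M" and f0: "\<And>x. x \<in> grid M \<Longrightarrow> 0 \<le> f x" and f1: "(\<Sum>x\<in>grid M. f x) = 1"
  defines "\<epsilon> \<equiv> 1 / (16 * real CARD('d) * 2 ^ CARD('d) * (of_int R)\<^sup>2)"
  shows "(\<Sum>x\<in>grid M. (walk M f x)\<^sup>2) - 1 / of_int R ^ CARD('d)
    \<le> (1 - \<epsilon>) * ((\<Sum>x\<in>grid M. (f x)\<^sup>2) - 1 / of_int R ^ CARD('d))"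
proof -
  let ?D = "dirichlet M f f" and ?a = "\<Sum>x\<in>grid M. (f x)\<^sup>2" and ?r = "1 / real_of_int R ^ CARD('d)"
  have "?a - ?r \<le> 4 * 2 ^ CARD('d) * (of_int R)\<^sup>2 * ?D"
    using nash_scale[OF R, of f] f0 f1 by simp
  then have "\<epsilon> * (?a - ?r) \<le> \<epsilon> * (4 * 2 ^ CARD('d) * (of_int R)\<^sup>2 * ?D)"
    by (intro mult_left_mono) (auto simp: \<epsilon>_def)
  also have "\<dots> = ?D / (4 * real CARD('d))" using R by (simp add: \<epsilon>_def field_simps)
  finally have "\<epsilon> * (?a - ?r) \<le> ?D / (4 * real CARD('d))" .
  moreover have "(1 - \<epsilon>) * (?a - ?r) = ?a - ?r - \<epsilon> * (?a - ?r)" by (simp only: left_diff_distrib mult_1)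
  ultimately show ?thesis using sum_walk_sq_le[of M f] by linarith
qed

lemma return_prob_double_scale:
  fixes x :: "'d::finite \<Rightarrow> int"
  defines "a \<equiv> \<lambda>M n. \<Sum>z\<in>grid M. ((walk M ^^ n) (dirac x) z)\<^sup>2"
  assumes x: "x \<in> grid M" and R: "0 < R" "2 * R \<le> M" and a: "a M n \<le> 2 / of_int R ^ CARD('d)"
  shows "a M (n + mixing CARD('d) * nat ((2 * R)\<^sup>2)) \<le> 2 / of_int (2 * R) ^ CARD('d)"
proof -
  define r where "r = 1 / real_of_int (2 * R) ^ CARD('d)"
  define \<epsilon> where "\<epsilon> = 1 / (16 * real CARD('d) * 2 ^ CARD('d) * (of_int (2 * R))\<^sup>2)"
  have nn: "0 \<le> (walk M ^^ n) (dirac x) z" if "z \<in> grid M" for z n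
    using that by (intro walk_iter_nonneg) (auto simp: dirac_nonneg)
  have mass: "(\<Sum>z\<in>grid M. (walk M ^^ n) (dirac x) z) = 1" for n
    using sum_dirac_mult[OF x, of "\<lambda>_. 1"] by (simp add: sum_walk_iter)
  have "1 * 1 * 1 * 1 \<le> 16 * real CARD('d) * 2 ^ CARD('d) * (of_int (2 * R))\<^sup>2"
    using R by (intro mult_mono one_le_power) (auto simp: Suc_le_eq)
  then have \<epsilon>: "0 < \<epsilon>" "\<epsilon> \<le> 1" by (simp_all add: \<epsilon>_def)
  have r0: "0 < r" using R by (simp add: r_def)
  have step: "a M (Suc m) - r \<le> (1 - \<epsilon>) * (a M m - r)" for m
    using return_prob_step[of "2 * R" M "(walk M ^^ m) (dirac x)"] R nn mass
    by (simp add: a_def r_def \<epsilon>_def)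
  have iter: "a M (n + m) - r \<le> (1 - \<epsilon>) ^ m * (a M n - r)" for m
  proof (induction m)
    case (Suc m)
    have "a M (n + Suc m) - r \<le> (1 - \<epsilon>) * (a M (n + m) - r)" using step[of "n + m"] by simp
    also have "\<dots> \<le> (1 - \<epsilon>) * ((1 - \<epsilon>) ^ m * (a M n - r))" using Suc \<epsilon> by (intro mult_left_mono) auto
    finally show ?case by (simp add: mult_ac)
  qed simp
  let ?m = "mixing CARD('d) * nat ((2 * R)\<^sup>2)"
  \<comment> \<open>\<open>mixing\<close> is the reciprocal of \<open>\<epsilon> * (2 * R)^2\<close>
    times \<open>d + 1\<close>.\<close>
  have \<epsilon>m: "\<epsilon> * real ?m = real CARD('d) + 1"
    using R by (simp add: \<epsilon>_def mixing_def field_simps)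
  have "(1 - \<epsilon>) ^ ?m \<le> exp (- \<epsilon>) ^ ?m"
    using \<epsilon> exp_ge_add_one_self[of "- \<epsilon>"] by (intro power_mono) auto
  also have "\<dots> = exp (- 1) ^ (CARD('d) + 1)"
  proof -
    have "exp (- \<epsilon>) ^ ?m = exp (- (\<epsilon> * real ?m))" unfolding exp_of_nat_mult[symmetric] by (simp add: mult.commute)
    also have "\<dots> = exp (real (CARD('d) + 1) * (- 1))" unfolding \<epsilon>m by simp
    finally show ?thesis unfolding exp_of_nat_mult .
  qed
  also have "\<dots> \<le> (1 / 2) ^ (CARD('d) + 1)"
    using exp_ge_add_one_self[of 1] by (intro power_mono) (auto simp: exp_minus field_simps)
  finally have small: "(1 - \<epsilon>) ^ ?m \<le> (1 / 2) ^ (CARD('d) + 1)" .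
  have "a M (n + ?m) - r \<le> (1 - \<epsilon>) ^ ?m * (a M n - r)" by (rule iter)
  also have "\<dots> \<le> (1 - \<epsilon>) ^ ?m * (2 / of_int R ^ CARD('d))"
    using a r0 \<epsilon> by (intro mult_left_mono) auto
  also have "\<dots> \<le> (1 / 2) ^ (CARD('d) + 1) * (2 / of_int R ^ CARD('d))"
    using small R by (intro mult_right_mono) auto
  \<comment> \<open>One factor one half cancels the 2 and the other \<open>d\<close> turn
    \<open>R ^ d\<close> into \<open>(2 * R) ^ d\<close>. The excess is then at most
    \<open>r\<close>, which restores the bound \<open>2 * r\<close> at the doubled scale.\<close>
  also have "\<dots> = r" by (simp add: r_def power_divide power_mult_distrib field_simps)
  finally show ?thesis by (simp add: r_def)
qed


lemma return_prob_dyadic: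
  fixes x :: "'d::finite \<Rightarrow> int"
  assumes x: "x \<in> grid M" and "2 ^ i \<le> M"
  shows "\<exists>n \<le> 2 * mixing CARD('d) * 4 ^ i.
    (\<Sum>z\<in>grid M. ((walk M ^^ n) (dirac x) z)\<^sup>2) \<le> 2 / (2 ^ i) ^ CARD('d)"
  using assms(2)
proof (induction i)
  case 0
  have "(\<Sum>z\<in>grid M. (dirac x z)\<^sup>2) = 1"
    using sum_dirac_mult[OF x, of "dirac x"] by (simp add: power2_eq_square dirac_def)
  then show ?case by (intro exI[of _ 0]) simp
next
  case (Suc i)
  have "0 \<le> (2::int) ^ i" by simp
  then have "2 ^ i \<le> M" using Suc.prems by (simp only: power_Suc)
  then obtain n where n: "n \<le> 2 * mixing CARD('d) * 4 ^ i"
    "(\<Sum>z\<in>grid M. ((walk M ^^ n) (dirac x) z)\<^sup>2) \<le> 2 / (2 ^ i) ^ CARD('d)"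
    using Suc.IH by blast
  have "nat ((2 * 2 ^ i)\<^sup>2) = 4 * 4 ^ i"
    by (simp add: power_mult_distrib nat_mult_distrib nat_power_eq power2_eq_square flip: power_mult_distrib)
  moreover have "(\<Sum>z\<in>grid M. ((walk M ^^ (n + mixing CARD('d) * nat ((2 * 2 ^ i)\<^sup>2))) (dirac x) z)\<^sup>2)
      \<le> 2 / of_int (2 * 2 ^ i) ^ CARD('d)"
    using Suc.prems n by (intro return_prob_double_scale[OF x]) auto
  \<comment> \<open>The time budget closes because
    \<open>2 * 4^i + 4 * 4^i \<le> 2 * 4^(i+1)\<close>: the durations grow geometrically and the
    last one dominates.\<close>
  ultimately show ?case using n(1) by (intro exI[of _ "n + mixing CARD('d) * (4 * 4 ^ i)"]) auto
qed

lemma return_prob_antimono: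
  fixes x :: "'d::finite \<Rightarrow> int"
  assumes "n \<le> m"
  shows "(\<Sum>z\<in>grid M. ((walk M ^^ m) f z)\<^sup>2) \<le> (\<Sum>z\<in>(grid M :: ('d \<Rightarrow> int) set). ((walk M ^^ n) f z)\<^sup>2)"
  using assms
proof (induction m rule: dec_induct)
  case (step m)
  have "0 \<le> dirichlet M h h" for h :: "('d \<Rightarrow> int) \<Rightarrow> real"
    unfolding dirichlet_def by (intro sum_nonneg) auto
  then have "(\<Sum>z\<in>grid M. (walk M h z)\<^sup>2) \<le> (\<Sum>z\<in>grid M. (h z)\<^sup>2)" for h :: "('d \<Rightarrow> int) \<Rightarrow> real"
    using sum_walk_sq_le[of M h] by (smt (verit) divide_nonneg_nonneg of_nat_0_le_iff)
  from this[of "(walk M ^^ m) f"] step show ?case by simp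
qed simp

lemma return_prob_le:
  fixes x :: "'d::finite \<Rightarrow> int"
  assumes x: "x \<in> grid M" and b: "1 \<le> b" "int b \<le> M"
  shows "(\<Sum>z\<in>grid M. ((walk M ^^ (2 * mixing CARD('d) * b\<^sup>2)) (dirac x) z)\<^sup>2) \<le> 2 * 2 ^ CARD('d) / real b ^ CARD('d)"
proof -
  \<comment> \<open>The largest power of two not exceeding \<open>b\<close>; replacing
    \<open>b\<close> by it costs at most \<open>2 ^ d\<close>.\<close>
  obtain i where i: "2 ^ i \<le> b" "b < 2 ^ (i + 1)"
    using ex_power_ivl1[of 2 b] b by auto
  then have "int (2 ^ i) \<le> int b" by linarith
  then have "2 ^ i \<le> M" using b by (simp only: of_nat_power of_nat_numeral)
  then obtain n where n: "n \<le> 2 * mixing CARD('d) * 4 ^ i"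
    "(\<Sum>z\<in>grid M. ((walk M ^^ n) (dirac x) z)\<^sup>2) \<le> 2 / (2 ^ i) ^ CARD('d)"
    using return_prob_dyadic[OF x] by blast
  have "(4::nat) ^ i = (2 ^ i)\<^sup>2" by (simp add: power2_eq_square flip: power_mult_distrib)
  also have "\<dots> \<le> b\<^sup>2" using i by (intro power_mono) auto
  finally have "n \<le> 2 * mixing CARD('d) * b\<^sup>2" using n(1) by (meson le_trans mult_le_mono2)
  then have "(\<Sum>z\<in>grid M. ((walk M ^^ (2 * mixing CARD('d) * b\<^sup>2)) (dirac x) z)\<^sup>2) \<le> 2 / (2 ^ i) ^ CARD('d)"
    by (rule order_trans[OF return_prob_antimono n(2)])
  also have "\<dots> = 2 * 2 ^ CARD('d) / (2 * 2 ^ i) ^ CARD('d)" by (simp add: power_mult_distrib)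
  also have "\<dots> \<le> 2 * 2 ^ CARD('d) / real b ^ CARD('d)"
  proof -
    have "real b \<le> real (2 ^ (i + 1))" using i(2) by (intro of_nat_mono) simp
    then show ?thesis using b by (intro divide_left_mono power_mono mult_pos_pos) auto
  qed
  finally show ?thesis .
qed

text \<open>Chapman-Kolmogorov at half the time writes a transition probability as an inner product
  of two kernels, and \<open>return_prob_le\<close> controls the square sum of each.\<close>

lemma walk_ultracontractive:
  fixes x :: "'d::finite \<Rightarrow> int"
  assumes x: "x \<in> grid M" and b: "1 \<le> b" "int b \<le> M" and g: "\<And>z. z \<in> grid M \<Longrightarrow> 0 \<le> g z"
  shows "(walk M ^^ (4 * mixing CARD('d) * b\<^sup>2)) g x \<le> 2 * 2 ^ CARD('d) / real b ^ CARD('d) * (\<Sum>z\<in>grid M. g z)"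
proof -
  define n where "n = 2 * mixing CARD('d) * b\<^sup>2"
  let ?C = "2 * 2 ^ CARD('d) / real b ^ CARD('d)"
  have N: "4 * mixing CARD('d) * b\<^sup>2 = n + n" by (simp add: n_def)
  have kernel: "(walk M ^^ (n + n)) (dirac x) z \<le> ?C" if z: "z \<in> grid M" for z
  proof -
    have amgm: "s * t \<le> (s\<^sup>2 + t\<^sup>2) / 2" for s t :: real
      using zero_le_power2[of "s - t"] by (simp add: power2_diff)
    have "(walk M ^^ (n + n)) (dirac x) z = (walk M ^^ n) ((walk M ^^ n) (dirac x)) z"
      by (simp add: funpow_add)
    also have "\<dots> = (\<Sum>s\<in>grid M. (walk M ^^ n) (dirac z) s * (walk M ^^ n) (dirac x) s)"
      by (rule walk_iter_kernel[OF z])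
    also have "\<dots> \<le> (\<Sum>s\<in>grid M. (((walk M ^^ n) (dirac z) s)\<^sup>2 + ((walk M ^^ n) (dirac x) s)\<^sup>2) / 2)"
      by (intro sum_mono amgm)
    also have "\<dots> = ((\<Sum>s\<in>grid M. ((walk M ^^ n) (dirac z) s)\<^sup>2) + (\<Sum>s\<in>grid M. ((walk M ^^ n) (dirac x) s)\<^sup>2)) / 2"
      by (simp add: sum.distrib flip: sum_divide_distrib)
    also have "\<dots> \<le> ?C"
      using return_prob_le[OF z b] return_prob_le[OF x b] by (simp add: n_def)
    finally show ?thesis .
  qed
  show ?thesis
    unfolding N walk_iter_kernel[OF x, of "n + n" g] sum_distrib_left
    by (intro sum_mono mult_right_mono kernel g)
qed

subsection \<open>Coercivity and exponential conjugation\<close>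

definition tile_of :: "nat \<Rightarrow> int \<Rightarrow> ('d \<Rightarrow> int) \<Rightarrow> 'd \<Rightarrow> int" where
  "tile_of b M x = (\<lambda>\<nu>. coarse (int b) M (x \<nu>))"

text \<open>The operator \<open>Q^* Q\<close> in integer coordinates. The divisor is
  \<open>b ^ d\<close>, as in \<open>Qop\<close>; it equals the number of points of the tile when
  \<open>b\<close> divides \<open>M\<close>.\<close>

definition block_mean :: "nat \<Rightarrow> int \<Rightarrow> (('d::finite \<Rightarrow> int) \<Rightarrow> real) \<Rightarrow> ('d \<Rightarrow> int) \<Rightarrow> real" where
  "block_mean b M u x = (\<Sum>z\<in>tile (int b) M (tile_of b M x). u z) / real b ^ CARD('d)"

definition ham :: "nat \<Rightarrow> int \<Rightarrow> real \<Rightarrow> real \<Rightarrow> (('d::finite \<Rightarrow> int) \<Rightarrow> real) \<Rightarrow> ('d \<Rightarrow> int) \<Rightarrow> real" where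
  "ham b M \<mu> \<alpha> u x = (real b)\<^sup>2 * lap M u x + \<mu> * u x + \<alpha> * block_mean b M u x"

text \<open>The quadratic form of \<open>block_mean\<close>, grouped by tiles.\<close>

definition block_energy :: "nat \<Rightarrow> int \<Rightarrow> (('d::finite \<Rightarrow> int) \<Rightarrow> real) \<Rightarrow> real" where
  "block_energy b M w = (\<Sum>\<kappa>\<in>grid (M div int b). (\<Sum>z\<in>tile (int b) M \<kappa>. w z)\<^sup>2 / real b ^ CARD('d))"

text \<open>Lower bound for the quadratic form of \<open>ham\<close>; \<open>4 * 2 ^ d\<close> is
  the constant of \<open>poincare_tiles\<close>.\<close>

definition gap :: "real \<Rightarrow> nat \<Rightarrow> real" where
  "gap \<alpha> d = \<alpha> / (4 * 2 ^ d)"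

section \<open>Second-order bounds for hyperbolic cosines\<close>

lemma cosh_le_quadratic:
  fixes t :: real
  assumes "\<bar>t\<bar> \<le> 1"
  shows "cosh t \<le> 1 + t\<^sup>2"
proof -
  have *: "cosh t \<le> 1 + t\<^sup>2" if t: "0 \<le> t" "t \<le> 1" for t :: real
  proof -
    \<comment> \<open>The upper bound \<open>1 - t + t^2\<close> for \<open>exp (- t)\<close>
      follows from this lower bound for \<open>exp t\<close>, because \<open>2 + 2 * t + t^2\<close>
      times it exceeds 2 by \<open>t^2 + t^3 + t^4\<close>.\<close>
    have "1 + t + t\<^sup>2 / 2 \<le> exp t" using t by (intro exp_lower_Taylor_quadratic)
    then have "(2 + 2 * t + t\<^sup>2) * exp (- t) \<le> 2 * exp t * exp (- t)"
      by (intro mult_right_mono) auto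
    also have "\<dots> = 2" by (simp add: exp_minus)
    also have "\<dots> \<le> 2 + (t\<^sup>2 + t ^ 3 + t ^ 4)" using t by simp
    also have "\<dots> = (2 + 2 * t + t\<^sup>2) * (1 - t + t\<^sup>2)"
      by (simp add: algebra_simps power2_eq_square power3_eq_cube power4_eq_xxxx)
    finally have "(2 + 2 * t + t\<^sup>2) * exp (- t) \<le> (2 + 2 * t + t\<^sup>2) * (1 - t + t\<^sup>2)" .
    moreover have "0 < 2 + 2 * t + t\<^sup>2" using t by (simp add: add_pos_nonneg)
    ultimately have "exp (- t) \<le> 1 - t + t\<^sup>2" by (simp only: mult_le_cancel_left_pos)
    moreover have "exp t \<le> 1 + t + t\<^sup>2" using t by (intro exp_bound)
    ultimately show ?thesis by (simp add: cosh_field_def)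
  qed
  show ?thesis using *[of "\<bar>t\<bar>"] assms by simp
qed

lemma abs_mult_le: "\<bar>s * t\<bar> \<le> (s\<^sup>2 + t\<^sup>2) / 2" for s t :: real
  using zero_le_power2[of "\<bar>s\<bar> - \<bar>t\<bar>"] by (simp add: power2_diff abs_mult)

lemma mult_cosh_ge:
  fixes s t r \<rho> :: real
  assumes "\<bar>r\<bar> \<le> \<rho>" "\<rho> \<le> 1"
  shows "s * t - \<rho>\<^sup>2 * ((s\<^sup>2 + t\<^sup>2) / 2) \<le> s * t * cosh r" "s * t * cosh r \<le> s * t + \<rho>\<^sup>2 * ((s\<^sup>2 + t\<^sup>2) / 2)"
proof -
  have "0 \<le> cosh r - 1" by (simp add: cosh_real_ge_1)
  have "cosh r - 1 \<le> r\<^sup>2" using cosh_le_quadratic[of r] assms by simp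
  also have "r\<^sup>2 \<le> \<rho>\<^sup>2" using assms by (simp add: abs_le_square_iff[symmetric])
  finally have "cosh r - 1 \<le> \<rho>\<^sup>2" .
  have "\<bar>s * t * (cosh r - 1)\<bar> = (cosh r - 1) * \<bar>s * t\<bar>"
    using \<open>0 \<le> cosh r - 1\<close> by (simp add: abs_mult)
  also have "\<dots> \<le> \<rho>\<^sup>2 * ((s\<^sup>2 + t\<^sup>2) / 2)"
    using \<open>0 \<le> cosh r - 1\<close> \<open>cosh r - 1 \<le> \<rho>\<^sup>2\<close> by (intro mult_mono abs_mult_le) auto
  finally have "\<bar>s * t * cosh r - s * t\<bar> \<le> \<rho>\<^sup>2 * ((s\<^sup>2 + t\<^sup>2) / 2)" by (simp add: algebra_simps)
  then show "s * t - \<rho>\<^sup>2 * ((s\<^sup>2 + t\<^sup>2) / 2) \<le> s * t * cosh r" "s * t * cosh r \<le> s * t + \<rho>\<^sup>2 * ((s\<^sup>2 + t\<^sup>2) / 2)"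
    by linarith+
qed

text \<open>Averaging the two weights \<open>exp (2 * s)\<close> and \<open>exp (2 * t)\<close>
  cancels the odd part in \<open>s - t\<close>. This is why the twist has no first-order
  effect.\<close>

lemma exp_mult_cosh_diff:
  fixes s t a c :: real
  shows "(exp s * a) * (exp t * c) * cosh (s - t) = ((exp s)\<^sup>2 + (exp t)\<^sup>2) * a * c / 2"
proof -
  have "(p * a) * (q * c) * ((p / q + q / p) / 2) = (p\<^sup>2 + q\<^sup>2) * a * c / 2" if "p \<noteq> 0" "q \<noteq> 0" for p q :: real
    using that by (simp add: field_simps power2_eq_square)
  moreover have "cosh (s - t) = (exp s / exp t + exp t / exp s) / 2"
    by (simp add: cosh_field_def exp_diff)
  ultimately show ?thesis by simp
qed

lemma dirichlet_nonneg: "0 \<le> dirichlet M w w"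
  unfolding dirichlet_def by (intro sum_nonneg) auto

lemma block_energy_nonneg: "0 \<le> block_energy b M w"
  unfolding block_energy_def by (intro sum_nonneg) auto

text \<open>Poincare on blocks of side \<open>b\<close> controls the fluctuations, and the block
  term controls the means. The bound uses \<alpha>0 instead of \<alpha> so that the constant does
  not vary with k and L.\<close>

lemma coercive:
  fixes w :: "('d::finite \<Rightarrow> int) \<Rightarrow> real"
  assumes b: "1 \<le> b" "int b \<le> M" "int b dvd M" and \<alpha>: "0 \<le> \<alpha>0" "\<alpha>0 \<le> 1" "\<alpha>0 \<le> \<alpha>"
  shows "gap \<alpha>0 CARD('d) * (\<Sum>x\<in>grid M. (w x)\<^sup>2) \<le> (real b)\<^sup>2 * dirichlet M w w + \<alpha> * block_energy b M w"
proof -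
  let ?D = "dirichlet M w w" and ?T = "block_energy b M w"
  define C :: real where "C = 4 * 2 ^ CARD('d)"
  have "1 \<le> (2::real) ^ CARD('d)" by simp
  then have C: "1 \<le> C" unfolding C_def by linarith
  have "(\<Sum>\<kappa>\<in>(grid (M div int b) :: ('d \<Rightarrow> int) set). (\<Sum>x\<in>tile (int b) M \<kappa>. w x)\<^sup>2 / card (tile (int b) M \<kappa>)) = ?T"
    unfolding block_energy_def using b by (intro sum.cong refl) (simp add: card_tile_eq)
  then have "(\<Sum>x\<in>grid M. (w x)\<^sup>2) \<le> C * (real b)\<^sup>2 * ?D + ?T"
    using poincare_tiles[of "int b" M w] b by (simp add: C_def)
  then have "gap \<alpha>0 CARD('d) * (\<Sum>x\<in>grid M. (w x)\<^sup>2) \<le> \<alpha>0 / C * (C * (real b)\<^sup>2 * ?D + ?T)"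
    using \<alpha> C by (auto simp: gap_def C_def[symmetric] intro!: divide_right_mono mult_left_mono)
  also have "\<dots> = \<alpha>0 * ((real b)\<^sup>2 * ?D) + \<alpha>0 / C * ?T" using C by (simp add: field_simps)
  also have "\<dots> \<le> 1 * ((real b)\<^sup>2 * ?D) + \<alpha> * ?T"
  proof (intro add_mono mult_right_mono block_energy_nonneg mult_nonneg_nonneg dirichlet_nonneg)
    have "\<alpha>0 / C \<le> \<alpha>0 / 1" using \<alpha> C by (intro divide_left_mono) auto
    then show "\<alpha>0 / C \<le> \<alpha>" using \<alpha> by simp
  qed (use \<alpha> in auto)
  finally show ?thesis by simp
qed

text \<open>Conjugating by \<open>exp \<theta>\<close> changes the quadratic forms only through \<open>cosh\<close> of increments of \<open>\<theta>\<close>,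
  that is, to second order in these increments.\<close>

lemma twisted_dirichlet_ge:
  fixes u \<theta> :: "('d::finite \<Rightarrow> int) \<Rightarrow> real"
  assumes \<theta>: "\<And>\<mu> x. \<bar>\<theta> x - \<theta> (up \<mu> x)\<bar> \<le> \<delta>" and \<delta>: "\<delta> \<le> 1"
  defines "w \<equiv> \<lambda>x. exp (\<theta> x) * u x"
  shows "dirichlet M w w - 2 * real CARD('d) * \<delta>\<^sup>2 * (\<Sum>x\<in>grid M. (w x)\<^sup>2)
    \<le> dirichlet M u (\<lambda>x. (exp (\<theta> x))\<^sup>2 * u x)"
proof -
  have edge: "(w x - w y) * (w x - w y) - \<delta>\<^sup>2 * ((w x)\<^sup>2 + (w y)\<^sup>2)
      \<le> (u x - u y) * ((exp (\<theta> x))\<^sup>2 * u x - (exp (\<theta> y))\<^sup>2 * u y)" if "\<bar>\<theta> x - \<theta> y\<bar> \<le> \<delta>" for x y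
  proof -
    have "(u x - u y) * ((exp (\<theta> x))\<^sup>2 * u x - (exp (\<theta> y))\<^sup>2 * u y)
        = (w x)\<^sup>2 + (w y)\<^sup>2 - 2 * (w x * w y * cosh (\<theta> x - \<theta> y))"
      unfolding w_def exp_mult_cosh_diff by (simp add: power_mult_distrib) (simp add: power2_eq_square algebra_simps)
    also have "\<dots> \<ge> (w x)\<^sup>2 + (w y)\<^sup>2 - 2 * (w x * w y + \<delta>\<^sup>2 * (((w x)\<^sup>2 + (w y)\<^sup>2) / 2))"
      by (intro diff_left_mono mult_left_mono mult_cosh_ge(2)[OF that \<delta>]) auto
    also have "(w x)\<^sup>2 + (w y)\<^sup>2 - 2 * (w x * w y + \<delta>\<^sup>2 * (((w x)\<^sup>2 + (w y)\<^sup>2) / 2))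
        = (w x - w y) * (w x - w y) - \<delta>\<^sup>2 * ((w x)\<^sup>2 + (w y)\<^sup>2)"
      by (simp add: field_simps power2_eq_square)
    finally show ?thesis .
  qed
  have "(\<Sum>\<mu>\<in>(UNIV::'d set). \<Sum>x\<in>edges M \<mu>. \<delta>\<^sup>2 * ((w x)\<^sup>2 + (w (up \<mu> x))\<^sup>2))
      \<le> (\<Sum>\<mu>\<in>(UNIV::'d set). \<delta>\<^sup>2 * (2 * (\<Sum>x\<in>grid M. (w x)\<^sup>2)))"
  proof (intro sum_mono)
    fix \<mu> :: 'd
    \<comment> \<open>In a fixed direction a point is the lower end of at most one edge and the
      upper end of at most one.\<close>
    have "(\<Sum>x\<in>edges M \<mu>. (w x)\<^sup>2) + (\<Sum>x\<in>edges M \<mu>. (w (up \<mu> x))\<^sup>2) \<le> 2 * (\<Sum>x\<in>grid M. (w x)\<^sup>2)"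
      using sum_edges_le[of M "\<lambda>x. (w x)\<^sup>2" \<mu>] sum_edges_up_le[of M "\<lambda>x. (w x)\<^sup>2" \<mu>] by simp
    then show "(\<Sum>x\<in>edges M \<mu>. \<delta>\<^sup>2 * ((w x)\<^sup>2 + (w (up \<mu> x))\<^sup>2)) \<le> \<delta>\<^sup>2 * (2 * (\<Sum>x\<in>grid M. (w x)\<^sup>2))"
      unfolding sum_distrib_left[symmetric] sum.distrib by (rule mult_left_mono) simp
  qed
  then have "(\<Sum>\<mu>\<in>(UNIV::'d set). \<Sum>x\<in>edges M \<mu>. \<delta>\<^sup>2 * ((w x)\<^sup>2 + (w (up \<mu> x))\<^sup>2))
      \<le> 2 * real CARD('d) * \<delta>\<^sup>2 * (\<Sum>x\<in>grid M. (w x)\<^sup>2)" by simp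
  moreover have "dirichlet M w w - (\<Sum>\<mu>\<in>(UNIV::'d set). \<Sum>x\<in>edges M \<mu>. \<delta>\<^sup>2 * ((w x)\<^sup>2 + (w (up \<mu> x))\<^sup>2))
    \<le> dirichlet M u (\<lambda>x. (exp (\<theta> x))\<^sup>2 * u x)"
    unfolding dirichlet_def sum_subtractf[symmetric] by (intro sum_mono edge \<theta>)
  ultimately show ?thesis by linarith
qed

lemma twisted_block_energy_ge:
  fixes u \<theta> :: "('d::finite \<Rightarrow> int) \<Rightarrow> real"
  assumes b: "1 \<le> b" "int b \<le> M" "int b dvd M"
    and \<theta>: "\<And>x y. x \<in> grid M \<Longrightarrow> y \<in> grid M \<Longrightarrow> tile_of b M x = tile_of b M y \<Longrightarrow> \<bar>\<theta> x - \<theta> y\<bar> \<le> \<rho>"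
    and \<rho>: "\<rho> \<le> 1"
  defines "w \<equiv> \<lambda>x. exp (\<theta> x) * u x"
  shows "block_energy b M w - \<rho>\<^sup>2 * (\<Sum>x\<in>grid M. (w x)\<^sup>2)
    \<le> (\<Sum>x\<in>grid M. (exp (\<theta> x))\<^sup>2 * u x * block_mean b M u x)"
proof -
  define B where "B = real b ^ CARD('d)"
  have B: "0 < B" using b by (simp add: B_def)
  let ?t = "\<lambda>\<kappa>::'d \<Rightarrow> int. tile (int b) M \<kappa>" and ?K = "grid (M div int b) :: ('d \<Rightarrow> int) set"
  have cell: "(\<Sum>x\<in>?t \<kappa>. w x)\<^sup>2 - \<rho>\<^sup>2 * (B * (\<Sum>x\<in>?t \<kappa>. (w x)\<^sup>2))
      \<le> (\<Sum>x\<in>?t \<kappa>. \<Sum>y\<in>?t \<kappa>. (exp (\<theta> x))\<^sup>2 * u x * u y)" if \<kappa>: "\<kappa> \<in> ?K" for \<kappa>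
  proof -
    let ?F = "\<lambda>x y. (exp (\<theta> x))\<^sup>2 * u x * u y"
    have card: "real (card (?t \<kappa>)) = B" using card_tile_eq[OF _ _ _ \<kappa>] b by (simp add: B_def)
    \<comment> \<open>Doubling and swapping \<open>x\<close> and \<open>y\<close> symmetrises the
      weight, as \<open>exp_mult_cosh_diff\<close> requires.\<close>
    have "2 * (\<Sum>x\<in>?t \<kappa>. \<Sum>y\<in>?t \<kappa>. ?F x y) = (\<Sum>x\<in>?t \<kappa>. \<Sum>y\<in>?t \<kappa>. ?F x y) + (\<Sum>x\<in>?t \<kappa>. \<Sum>y\<in>?t \<kappa>. ?F y x)"
      using sum.swap[of ?F "?t \<kappa>" "?t \<kappa>"] by simp
    also have "\<dots> = (\<Sum>x\<in>?t \<kappa>. \<Sum>y\<in>?t \<kappa>. ?F x y + ?F y x)" by (simp add: sum.distrib)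
    also have "\<dots> \<ge> (\<Sum>x\<in>?t \<kappa>. \<Sum>y\<in>?t \<kappa>. 2 * (w x * w y - \<rho>\<^sup>2 * (((w x)\<^sup>2 + (w y)\<^sup>2) / 2)))"
    proof (intro sum_mono)
      fix x y assume "x \<in> ?t \<kappa>" "y \<in> ?t \<kappa>"
      then have "\<bar>\<theta> x - \<theta> y\<bar> \<le> \<rho>" by (intro \<theta>) (auto simp: tile_def tile_of_def)
      from mult_cosh_ge(1)[OF this \<rho>, of "w x" "w y"]
      have "w x * w y - \<rho>\<^sup>2 * (((w x)\<^sup>2 + (w y)\<^sup>2) / 2) \<le> w x * w y * cosh (\<theta> x - \<theta> y)" .
      also have "2 * (w x * w y * cosh (\<theta> x - \<theta> y)) = ?F x y + ?F y x"
        unfolding w_def exp_mult_cosh_diff by (simp add: algebra_simps)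
      then have "w x * w y * cosh (\<theta> x - \<theta> y) = (?F x y + ?F y x) / 2" by simp
      finally show "2 * (w x * w y - \<rho>\<^sup>2 * (((w x)\<^sup>2 + (w y)\<^sup>2) / 2)) \<le> ?F x y + ?F y x" by simp
    qed
    also have "(\<Sum>x\<in>?t \<kappa>. \<Sum>y\<in>?t \<kappa>. 2 * (w x * w y - \<rho>\<^sup>2 * (((w x)\<^sup>2 + (w y)\<^sup>2) / 2)))
      = 2 * ((\<Sum>x\<in>?t \<kappa>. w x)\<^sup>2 - \<rho>\<^sup>2 * (B * (\<Sum>x\<in>?t \<kappa>. (w x)\<^sup>2)))"
    proof -
      have 1: "(\<Sum>x\<in>?t \<kappa>. \<Sum>y\<in>?t \<kappa>. w x * w y) = (\<Sum>x\<in>?t \<kappa>. w x)\<^sup>2"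
        by (simp add: power2_eq_square sum_product)
      have 2: "(\<Sum>x\<in>?t \<kappa>. \<Sum>y\<in>?t \<kappa>. ((w x)\<^sup>2 + (w y)\<^sup>2) / 2) = B * (\<Sum>x\<in>?t \<kappa>. (w x)\<^sup>2)"
      proof -
        have "(\<Sum>y\<in>?t \<kappa>. ((w x)\<^sup>2 + (w y)\<^sup>2) / 2) = (B * (w x)\<^sup>2 + (\<Sum>y\<in>?t \<kappa>. (w y)\<^sup>2)) / 2" for x
          by (simp only: sum_divide_distrib[symmetric] sum.distrib sum_constant card)
        then show ?thesis
          by (simp only: sum_divide_distrib[symmetric] sum.distrib sum_distrib_left[symmetric] sum_constant card) simp
      qed
      show ?thesis unfolding 1[symmetric] 2[symmetric]
        by (simp only: sum_distrib_left sum_subtractf right_diff_distrib)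
    qed
    finally show ?thesis by simp
  qed
  have "block_energy b M w - \<rho>\<^sup>2 * (\<Sum>x\<in>grid M. (w x)\<^sup>2)
      = (\<Sum>\<kappa>\<in>?K. ((\<Sum>x\<in>?t \<kappa>. w x)\<^sup>2 - \<rho>\<^sup>2 * (B * (\<Sum>x\<in>?t \<kappa>. (w x)\<^sup>2))) / B)"
  proof -
    have eq: "(s - \<rho>\<^sup>2 * (B * t)) / B = s / B - \<rho>\<^sup>2 * t" for s t using B by (simp add: field_simps)
    have "(\<Sum>x\<in>grid M. (w x)\<^sup>2) = (\<Sum>\<kappa>\<in>?K. \<Sum>x\<in>?t \<kappa>. (w x)\<^sup>2)"
      using b by (intro sum_tiles[symmetric]) auto
    then show ?thesis
      unfolding eq by (simp only: sum_subtractf block_energy_def B_def[symmetric] sum_distrib_left)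
  qed
  also have "\<dots> \<le> (\<Sum>\<kappa>\<in>?K. (\<Sum>x\<in>?t \<kappa>. \<Sum>y\<in>?t \<kappa>. (exp (\<theta> x))\<^sup>2 * u x * u y) / B)"
    using B by (intro sum_mono divide_right_mono cell) auto
  also have "\<dots> = (\<Sum>\<kappa>\<in>?K. \<Sum>x\<in>?t \<kappa>. (exp (\<theta> x))\<^sup>2 * u x * block_mean b M u x)"
  proof (intro sum.cong refl)
    fix \<kappa> assume "\<kappa> \<in> ?K"
    have "tile_of b M x = \<kappa>" if "x \<in> ?t \<kappa>" for x using that by (simp add: tile_def tile_of_def)
    then have eq: "(\<Sum>x\<in>?t \<kappa>. (exp (\<theta> x))\<^sup>2 * u x * block_mean b M u x)
      = (\<Sum>x\<in>?t \<kappa>. (exp (\<theta> x))\<^sup>2 * u x * ((\<Sum>y\<in>?t \<kappa>. u y) / B))"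
      by (intro sum.cong refl) (simp add: block_mean_def B_def)
    show "(\<Sum>x\<in>?t \<kappa>. \<Sum>y\<in>?t \<kappa>. (exp (\<theta> x))\<^sup>2 * u x * u y) / B
        = (\<Sum>x\<in>?t \<kappa>. (exp (\<theta> x))\<^sup>2 * u x * block_mean b M u x)"
      unfolding eq by (simp add: sum_divide_distrib sum_distrib_left)
  qed
  also have "\<dots> = (\<Sum>x\<in>grid M. (exp (\<theta> x))\<^sup>2 * u x * block_mean b M u x)"
    using b by (intro sum_tiles) auto
  finally show ?thesis .
qed

text \<open>Edge increments \<open>\<rho> / b\<close> meet the prefactor \<open>b^2\<close> and
  leave an error \<open>2 * d * \<rho>^2\<close> free of \<open>b\<close>; oscillation on a block
  adds \<open>(d * \<rho>)^2\<close>. Together they are at most \<open>3 * (d * \<rho>)^2\<close> as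
  \<open>d \<ge> 1\<close>, while the mass contributes a nonnegative term.\<close>

lemma twisted_coercive:
  fixes u \<theta> :: "('d::finite \<Rightarrow> int) \<Rightarrow> real"
  assumes b: "1 \<le> b" "int b \<le> M" "int b dvd M" and \<alpha>: "0 \<le> \<alpha>0" "\<alpha>0 \<le> \<alpha>" "\<alpha> \<le> 1" and \<mu>0: "0 \<le> \<mu>0"
    and \<theta>: "\<And>\<mu> x. \<bar>\<theta> x - \<theta> (up \<mu> x)\<bar> \<le> \<rho> / real b"
    and \<theta>': "\<And>x y. x \<in> grid M \<Longrightarrow> y \<in> grid M \<Longrightarrow> tile_of b M x = tile_of b M y \<Longrightarrow> \<bar>\<theta> x - \<theta> y\<bar> \<le> real CARD('d) * \<rho>"
    and \<rho>: "0 \<le> \<rho>" "real CARD('d) * \<rho> \<le> 1"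
  shows "(gap \<alpha>0 CARD('d) - 3 * (real CARD('d) * \<rho>)\<^sup>2) * (\<Sum>x\<in>grid M. (exp (\<theta> x) * u x)\<^sup>2)
     \<le> (\<Sum>x\<in>grid M. (exp (\<theta> x))\<^sup>2 * u x * ham b M \<mu>0 \<alpha> u x)"
proof -
  define w where "w = (\<lambda>x. exp (\<theta> x) * u x)"
  define S where "S = (\<Sum>x\<in>grid M. (w x)\<^sup>2)"
  let ?d = "real CARD('d)"
  let ?v = "\<lambda>x. (exp (\<theta> x))\<^sup>2 * u x"
  have S0: "0 \<le> S" unfolding S_def by (intro sum_nonneg) auto
  have d: "1 \<le> ?d" by (simp add: Suc_le_eq)
  have "\<rho> \<le> ?d * \<rho>" using d \<rho> by (simp add: mult_le_cancel_right1)
  also have "?d * \<rho> \<le> real b" using \<rho> b by linarith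
  finally have "\<rho> / real b \<le> 1" using b by simp
  then have "dirichlet M w w - 2 * ?d * (\<rho> / real b)\<^sup>2 * S \<le> dirichlet M u ?v"
    unfolding w_def S_def by (intro twisted_dirichlet_ge \<theta>)
  then have "(real b)\<^sup>2 * (dirichlet M w w - 2 * ?d * (\<rho> / real b)\<^sup>2 * S) \<le> (real b)\<^sup>2 * dirichlet M u ?v"
    by (intro mult_left_mono) auto
  moreover have "(real b)\<^sup>2 * (2 * ?d * (\<rho> / real b)\<^sup>2 * S) = 2 * (?d * \<rho>\<^sup>2 * S)"
    using b by (simp add: power_divide)
  ultimately have 1: "(real b)\<^sup>2 * dirichlet M w w - 2 * (?d * \<rho>\<^sup>2 * S) \<le> (real b)\<^sup>2 * dirichlet M u ?v"
    by (simp only: right_diff_distrib)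
  have "block_energy b M w - (?d * \<rho>)\<^sup>2 * S \<le> (\<Sum>x\<in>grid M. ?v x * block_mean b M u x)"
    unfolding w_def S_def by (rule twisted_block_energy_ge[OF b \<theta>' \<rho>(2)])
  then have "\<alpha> * (block_energy b M w - (?d * \<rho>)\<^sup>2 * S) \<le> \<alpha> * (\<Sum>x\<in>grid M. ?v x * block_mean b M u x)"
    using \<alpha> by (intro mult_left_mono) auto
  moreover have "\<alpha> * ((?d * \<rho>)\<^sup>2 * S) \<le> 1 * ((?d * \<rho>)\<^sup>2 * S)"
    using \<alpha> S0 by (intro mult_right_mono) auto
  ultimately have 2: "\<alpha> * block_energy b M w - (?d * \<rho>)\<^sup>2 * S \<le> \<alpha> * (\<Sum>x\<in>grid M. ?v x * block_mean b M u x)"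
    by (simp add: right_diff_distrib)
  have 3: "0 \<le> \<mu>0 * (\<Sum>x\<in>grid M. ?v x * u x)"
  proof -
    have eq: "?v x * u x = (exp (\<theta> x) * u x)\<^sup>2" for x by (simp add: power2_eq_square mult_ac)
    show ?thesis unfolding eq using \<mu>0 by (intro mult_nonneg_nonneg sum_nonneg) auto
  qed
  have "1 * (?d * \<rho>\<^sup>2) \<le> ?d * (?d * \<rho>\<^sup>2)" using d by (intro mult_right_mono) auto
  also have "\<dots> = (?d * \<rho>)\<^sup>2" by (simp add: power2_eq_square)
  finally have "?d * \<rho>\<^sup>2 \<le> (?d * \<rho>)\<^sup>2" by (simp only: mult_1)
  then have "?d * \<rho>\<^sup>2 * S \<le> (?d * \<rho>)\<^sup>2 * S" using S0 by (rule mult_right_mono)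
  then have 4: "2 * (?d * \<rho>\<^sup>2 * S) + (?d * \<rho>)\<^sup>2 * S \<le> 3 * ((?d * \<rho>)\<^sup>2 * S)" by linarith
  have 5: "gap \<alpha>0 CARD('d) * S \<le> (real b)\<^sup>2 * dirichlet M w w + \<alpha> * block_energy b M w"
    unfolding S_def using \<alpha> by (intro coercive b) auto
  have "(\<Sum>x\<in>grid M. ?v x * ham b M \<mu>0 \<alpha> u x)
      = (\<Sum>x\<in>grid M. (real b)\<^sup>2 * (?v x * lap M u x) + \<mu>0 * (?v x * u x) + \<alpha> * (?v x * block_mean b M u x))"
    by (intro sum.cong refl) (simp only: ham_def distrib_left mult_ac)
  also have "\<dots> = (real b)\<^sup>2 * dirichlet M u ?v + \<mu>0 * (\<Sum>x\<in>grid M. ?v x * u x)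
      + \<alpha> * (\<Sum>x\<in>grid M. ?v x * block_mean b M u x)"
    by (simp only: sum.distrib sum_distrib_left[symmetric] sum_mult_lap)
  finally have "gap \<alpha>0 CARD('d) * S - 3 * ((?d * \<rho>)\<^sup>2 * S) \<le> (\<Sum>x\<in>grid M. ?v x * ham b M \<mu>0 \<alpha> u x)"
    using 1 2 3 4 5 by linarith
  then have "(gap \<alpha>0 CARD('d) - 3 * (?d * \<rho>)\<^sup>2) * S \<le> (\<Sum>x\<in>grid M. ?v x * ham b M \<mu>0 \<alpha> u x)"
    by (simp only: left_diff_distrib mult.assoc)
  then show ?thesis unfolding S_def w_def .
qed

text \<open>This distance changes by exactly 1 along a lattice edge in the free argument, up to
  sign, and its exponential factors over the coordinates. It is measured in lattice steps, so rates
  carry a factor \<open>1 / b\<close>.\<close>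

definition l1 :: "('d::finite \<Rightarrow> int) \<Rightarrow> ('d \<Rightarrow> int) \<Rightarrow> real" where
  "l1 p x = (\<Sum>\<nu>\<in>UNIV. \<bar>real_of_int (x \<nu>) - real_of_int (p \<nu>)\<bar>)"

lemma l1_commute: "l1 p x = l1 x p"
  unfolding l1_def by (intro sum.cong refl) (rule abs_minus_commute)

lemma l1_triangle: "l1 p x \<le> l1 p y + l1 y x"
  unfolding l1_def sum.distrib[symmetric] by (intro sum_mono) linarith

lemma l1_diff_le: "\<bar>l1 p x - l1 p y\<bar> \<le> l1 x y"
  using l1_triangle[of p x y] l1_triangle[of p y x] by (simp add: l1_commute[of y x])

lemma l1_up: "l1 x (up \<mu> x) = 1"
proof -
  have "l1 x (up \<mu> x) = (\<Sum>\<nu>\<in>UNIV. if \<nu> = \<mu> then 1 else 0)"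
    unfolding l1_def by (intro sum.cong) (auto simp: up_def)
  then show ?thesis by simp
qed

lemma l1_tile:
  fixes x y :: "'d::finite \<Rightarrow> int"
  assumes b: "1 \<le> b" "int b \<le> M" "int b dvd M" and xy: "x \<in> grid M" "y \<in> grid M" "tile_of b M x = tile_of b M y"
  shows "l1 x y \<le> real CARD('d) * real b"
proof -
  have b': "0 < int b" using b by simp
  have "\<bar>real_of_int (y \<nu>) - real_of_int (x \<nu>)\<bar> \<le> real b" for \<nu>
  proof -
    define j where "j = coarse (int b) M (x \<nu>)"
    have j: "0 \<le> j" "j < M div int b"
      using coarse_in_grid[OF b' b(2) xy(1)] by (auto simp: j_def grid_def cells_def)
    have jy: "coarse (int b) M (y \<nu>) = j" using xy(3) by (simp add: j_def tile_of_def fun_eq_iff)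
    let ?h = "if j = M div int b - 1 then M else (j + 1) * int b"
    have "j * int b \<le> z \<and> z < ?h" if "z = x \<nu> \<or> z = y \<nu>" for z
      using coarse_eq_iff[OF b' b(2) j, of z] xy that jy by (auto simp: j_def grid_def cells_def)
    from this[of "x \<nu>"] this[of "y \<nu>"] tile_length(3)[OF b' b(2) j b(3)]
    have "\<bar>y \<nu> - x \<nu>\<bar> \<le> int b" by linarith
    then show ?thesis by linarith
  qed
  then have "l1 x y \<le> (\<Sum>\<nu>\<in>(UNIV::'d set). real b)" unfolding l1_def by (intro sum_mono)
  then show ?thesis by simp
qed

text \<open>Solves \<open>3 * (d * rate)^2 = gap / 2\<close>, so that the twist consumes half of the
  gap.\<close>

definition rate :: "real \<Rightarrow> nat \<Rightarrow> real" where
  "rate \<alpha> d = sqrt (gap \<alpha> d / 6) / real d"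

lemma gap_pos: "0 < \<alpha> \<Longrightarrow> 0 < gap \<alpha> d"
  by (simp add: gap_def)

lemma gap_le:
  assumes "\<alpha> \<le> 1" shows "gap \<alpha> d \<le> 1 / 4"
proof -
  have "1 \<le> (2::real) ^ d" by simp
  then have "4 * \<alpha> \<le> 4 * 2 ^ d" using assms by linarith
  then show ?thesis by (simp add: gap_def field_simps)
qed

lemma rate_pos: "0 < \<alpha> \<Longrightarrow> 0 < d \<Longrightarrow> 0 < rate \<alpha> d"
  by (simp add: rate_def gap_pos)

lemma rate_sq: "0 < \<alpha> \<Longrightarrow> 0 < d \<Longrightarrow> 3 * (real d * rate \<alpha> d)\<^sup>2 = gap \<alpha> d / 2"
  using gap_pos[of \<alpha> d] by (simp add: rate_def)

lemma rate_le:
  assumes "0 < \<alpha>" "\<alpha> \<le> 1" "0 < d" shows "real d * rate \<alpha> d \<le> 1 / 2"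
proof -
  have "(real d * rate \<alpha> d)\<^sup>2 \<le> (1 / 2)\<^sup>2"
    using rate_sq[OF assms(1,3)] gap_le[OF assms(2), of d] by (simp add: power2_eq_square)
  then show ?thesis by (rule power2_le_imp_le) simp
qed

subsection \<open>The Combes-Thomas estimate\<close>

lemma combes_thomas:
  fixes u :: "('d::finite \<Rightarrow> int) \<Rightarrow> real"
  assumes b: "1 \<le> b" "int b \<le> M" "int b dvd M" and \<alpha>: "0 < \<alpha>0" "\<alpha>0 \<le> \<alpha>" "\<alpha> \<le> 1" and \<mu>0: "0 \<le> \<mu>0"
    and p: "p \<in> grid M"
    and u: "\<And>x. x \<in> grid M \<Longrightarrow> ham b M \<mu>0 \<alpha> u x = (if tile_of b M x = tile_of b M p then 1 else 0)"
  shows "(\<Sum>x\<in>grid M. (exp (rate \<alpha>0 CARD('d) / real b * l1 p x) * u x)\<^sup>2)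
    \<le> 36 / (gap \<alpha>0 CARD('d))\<^sup>2 * real b ^ CARD('d)"
proof -
  define \<rho> where "\<rho> = rate \<alpha>0 CARD('d)"
  define g where "g = gap \<alpha>0 CARD('d)"
  define \<theta> where "\<theta> = (\<lambda>x. \<rho> / real b * l1 p x)"
  define w where "w = (\<lambda>x. exp (\<theta> x) * u x)"
  define S where "S = (\<Sum>x\<in>grid M. (w x)\<^sup>2)"
  let ?t = "tile (int b) M (tile_of b M p)"
  have \<rho>: "0 < \<rho>" "real CARD('d) * \<rho> \<le> 1 / 2" "3 * (real CARD('d) * \<rho>)\<^sup>2 = g / 2"
    using \<alpha> rate_pos[of \<alpha>0 "CARD('d)"] rate_le[of \<alpha>0 "CARD('d)"] rate_sq[of \<alpha>0 "CARD('d)"] by (auto simp: \<rho>_def g_def)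
  have g: "0 < g" using \<alpha> by (simp add: g_def gap_pos)
  have lip: "\<bar>\<theta> x - \<theta> y\<bar> \<le> \<rho> / real b * l1 x y" for x y
  proof -
    have "\<bar>\<theta> x - \<theta> y\<bar> = \<rho> / real b * \<bar>l1 p x - l1 p y\<bar>"
      using \<rho> unfolding \<theta>_def right_diff_distrib[symmetric] abs_mult by simp
    also have "\<dots> \<le> \<rho> / real b * l1 x y" using \<rho> by (intro mult_left_mono l1_diff_le) auto
    finally show ?thesis .
  qed
  have step: "\<bar>\<theta> x - \<theta> (up \<mu> x)\<bar> \<le> \<rho> / real b" for \<mu> x
    using lip[of x "up \<mu> x"] by (simp add: l1_up)
  have tile: "\<bar>\<theta> x - \<theta> y\<bar> \<le> real CARD('d) * \<rho>"
    if "x \<in> grid M" "y \<in> grid M" "tile_of b M x = tile_of b M y" for x y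
  proof -
    have "\<rho> / real b * l1 x y \<le> \<rho> / real b * (real CARD('d) * real b)"
      using l1_tile[OF b that] \<rho> by (intro mult_left_mono) auto
    also have "\<dots> = real CARD('d) * \<rho>" using b by simp
    finally show ?thesis using lip[of x y] by linarith
  qed
  have "(g - 3 * (real CARD('d) * \<rho>)\<^sup>2) * S \<le> (\<Sum>x\<in>grid M. (exp (\<theta> x))\<^sup>2 * u x * ham b M \<mu>0 \<alpha> u x)"
    unfolding g_def S_def w_def using \<alpha> \<rho>
    by (intro twisted_coercive[OF b _ \<alpha>(2,3) \<mu>0 step tile]) auto
  then have "g / 2 * S \<le> (\<Sum>x\<in>grid M. (exp (\<theta> x))\<^sup>2 * u x * ham b M \<mu>0 \<alpha> u x)"
    unfolding \<rho>(3) by simp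
  also have "\<dots> = (\<Sum>x\<in>?t. (exp (\<theta> x))\<^sup>2 * u x)"
    by (rule sum.mono_neutral_cong_right) (auto simp: tile_def u tile_of_def)
  also have "\<dots> \<le> (\<Sum>x\<in>?t. g / 4 * (w x)\<^sup>2 + 9 / g)"
  proof (intro sum_mono)
    fix x assume "x \<in> ?t"
    then have x: "x \<in> grid M" "tile_of b M x = tile_of b M p" by (auto simp: tile_def tile_of_def)
    \<comment> \<open>On the block of \<open>p\<close>, where the source lives, the weight stays
      below \<open>exp 1 \<le> 3\<close>; the 9 and the 36 come from this 3.\<close>
    have "\<theta> p = 0" by (simp add: \<theta>_def l1_def)
    then have "\<theta> x \<le> 1" using tile[OF x(1) p x(2)] \<rho> by linarith
    then have "exp (\<theta> x) \<le> exp 1" by simp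
    then have e: "exp (\<theta> x) \<le> 3" using exp_le by linarith
    have "(exp (\<theta> x))\<^sup>2 * u x = exp (\<theta> x) * w x" by (simp add: w_def power2_eq_square)
    also have "\<dots> \<le> 3 * \<bar>w x\<bar>" by (rule order_trans[OF abs_ge_self]) (use e in \<open>simp add: abs_mult mult_right_mono\<close>)
    \<comment> \<open>Young's inequality with \<open>g / 4\<close>, half of the available
      \<open>g / 2\<close>, so that the weighted sum can be absorbed on the left.\<close>
    also have "\<dots> \<le> g / 4 * (w x)\<^sup>2 + 9 / g"
    proof -
      have "0 \<le> (g / 2 * \<bar>w x\<bar> - 3)\<^sup>2" by simp
      also have "\<dots> = (g / 2)\<^sup>2 * (w x)\<^sup>2 + 9 - g * (3 * \<bar>w x\<bar>)"
        unfolding power2_diff power_mult_distrib power2_abs by simp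
      also have "(g / 2)\<^sup>2 * (w x)\<^sup>2 + 9 = g * (g / 4 * (w x)\<^sup>2 + 9 / g)"
        using g by (simp add: distrib_left power2_eq_square)
      finally have "g * (3 * \<bar>w x\<bar>) \<le> g * (g / 4 * (w x)\<^sup>2 + 9 / g)" by simp
      then show ?thesis using g by (simp only: mult_le_cancel_left_pos)
    qed
    finally show "(exp (\<theta> x))\<^sup>2 * u x \<le> g / 4 * (w x)\<^sup>2 + 9 / g" .
  qed
  also have "\<dots> = g / 4 * (\<Sum>x\<in>?t. (w x)\<^sup>2) + real (card ?t) * (9 / g)"
    by (simp only: sum.distrib sum_distrib_left[symmetric] sum_constant)
  also have "real (card ?t) = real b ^ CARD('d)"
    using b coarse_in_grid[of "int b" M p] p by (subst card_tile_eq) (auto simp: tile_of_def)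
  also have "(\<Sum>x\<in>?t. (w x)\<^sup>2) \<le> S" unfolding S_def by (intro sum_mono2) (auto simp: tile_def)
  finally have "g / 2 * S \<le> g / 4 * S + real b ^ CARD('d) * (9 / g)" using g by simp
  moreover have "g / 2 * S = g / 4 * S + g / 4 * S" by (simp flip: distrib_right)
  ultimately have "g / 4 * S \<le> 9 / g * real b ^ CARD('d)" by (simp only: add_le_cancel_left mult.commute)
  then have "S \<le> 36 / g\<^sup>2 * real b ^ CARD('d)" using g by (simp add: field_simps power2_eq_square)
  then show ?thesis by (simp add: S_def w_def \<theta>_def g_def \<rho>_def)
qed

subsection \<open>Exponential weights under the walk\<close>

text \<open>A product of one-dimensional eigenfunctions of the second difference, comparable to
  \<open>exp (s * l1 x t)\<close>. The exponential itself has a kink at \<open>x\<close>, where one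
  step costs a first-order amount in \<open>s\<close>; the smooth weight costs only a second-order
  one.\<close>

definition cosh_weight :: "real \<Rightarrow> ('d::finite \<Rightarrow> int) \<Rightarrow> ('d \<Rightarrow> int) \<Rightarrow> real" where
  "cosh_weight s x t = (\<Prod>\<nu>\<in>UNIV. cosh (s * real_of_int (t \<nu> - x \<nu>)))"

lemma cosh_weight_fun_upd:
  "cosh_weight s x (t(\<mu> := n)) = cosh (s * real_of_int (n - x \<mu>)) * (\<Prod>\<nu>\<in>UNIV - {\<mu>}. cosh (s * real_of_int (t \<nu> - x \<nu>)))"
  unfolding cosh_weight_def by (subst prod.remove[of _ \<mu>]) auto

lemma exp_l1_le_cosh_weight:
  fixes x t :: "'d::finite \<Rightarrow> int"
  assumes "0 \<le> s"
  shows "exp (s * l1 x t) \<le> 2 ^ CARD('d) * cosh_weight s x t"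
proof -
  have "exp (s * l1 x t) = (\<Prod>\<nu>\<in>UNIV. exp (s * \<bar>real_of_int (t \<nu>) - real_of_int (x \<nu>)\<bar>))"
    by (simp add: l1_def sum_distrib_left exp_sum)
  also have "\<dots> \<le> (\<Prod>\<nu>\<in>UNIV. 2 * cosh (s * real_of_int (t \<nu> - x \<nu>)))"
  proof (intro prod_mono conjI)
    fix \<nu>
    have "exp \<bar>r\<bar> \<le> 2 * cosh r" for r :: real by (cases "0 \<le> r") (auto simp: cosh_field_def)
    from this[of "s * real_of_int (t \<nu> - x \<nu>)"]
    show "exp (s * \<bar>real_of_int (t \<nu>) - real_of_int (x \<nu>)\<bar>) \<le> 2 * cosh (s * real_of_int (t \<nu> - x \<nu>))"
      using assms by (simp add: abs_mult)
  qed auto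
  also have "\<dots> = 2 ^ CARD('d) * cosh_weight s x t" by (simp add: cosh_weight_def prod.distrib)
  finally show ?thesis .
qed

text \<open>At a boundary point the walk replaces an exterior neighbour by the point itself, which lies
  closer to \<open>x\<close>; hence \<open>cosh_weight\<close> stays a supersolution under the Neumann boundary condition.\<close>

lemma walk_cosh_weight_le:
  fixes x t :: "'d::finite \<Rightarrow> int"
  assumes x: "x \<in> grid M" and t: "t \<in> grid M" and s: "0 \<le> s" "s \<le> 1"
  shows "walk M (cosh_weight s x) t \<le> (1 + s\<^sup>2) * cosh_weight s x t"
proof -
  let ?W = "cosh_weight s x"
  let ?c = "\<lambda>n. cosh (s * real_of_int n)"
  have pos: "0 \<le> (\<Prod>\<nu>\<in>A. cosh (s * real_of_int (t \<nu> - x \<nu>)))" for A by (intro prod_nonneg) auto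
  have W0: "0 \<le> ?W t" using pos[of UNIV] by (simp add: cosh_weight_def)
  have mono: "?c n \<le> ?c m" if "\<bar>n\<bar> \<le> \<bar>m\<bar>" for n m
  proof -
    have "\<bar>s * real_of_int n\<bar> \<le> \<bar>s * real_of_int m\<bar>" 
      unfolding abs_mult using that by (intro mult_left_mono) linarith+
    then have "cosh \<bar>s * real_of_int n\<bar> \<le> cosh \<bar>s * real_of_int m\<bar>"
      by (subst cosh_real_nonneg_le_iff) auto
    then show ?thesis by simp
  qed
  have self: "?W t = ?c (t \<mu> - x \<mu>) * (\<Prod>\<nu>\<in>UNIV - {\<mu>}. ?c (t \<nu> - x \<nu>))" for \<mu>
    using cosh_weight_fun_upd[of s x t \<mu> "t \<mu>"] by simp
  have bd: "0 \<le> t \<nu>" "t \<nu> < M" "0 \<le> x \<nu>" "x \<nu> < M" for \<nu>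
    using t x by (auto simp: grid_def cells_def)
  have "nb M ?W t (up \<mu> t) \<le> ?W (up \<mu> t)" for \<mu>
  proof (cases "up \<mu> t \<in> grid M")
    case False
    have "\<not> t \<mu> + 1 < M"
    proof
      assume "t \<mu> + 1 < M"
      then have "0 \<le> up \<mu> t \<nu> \<and> up \<mu> t \<nu> < M" for \<nu> using bd[of \<nu>] by (auto simp: up_def)
      then show False using False by (simp add: grid_def cells_def)
    qed
    then have "?c (t \<mu> - x \<mu>) \<le> ?c (t \<mu> + 1 - x \<mu>)" using bd[of \<mu>] by (intro mono) auto
    then show ?thesis using False unfolding up_def
      by (simp add: nb_def cosh_weight_fun_upd self[of \<mu>] mult_right_mono pos del: of_int_diff)
  qed (simp add: nb_def)
  moreover have "nb M ?W t (dn \<mu> t) \<le> ?W (dn \<mu> t)" for \<mu>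
  proof (cases "dn \<mu> t \<in> grid M")
    case False
    have "\<not> 0 < t \<mu>"
    proof
      assume "0 < t \<mu>"
      then have "0 \<le> dn \<mu> t \<nu> \<and> dn \<mu> t \<nu> < M" for \<nu> using bd[of \<nu>] by (auto simp: dn_def)
      then show False using False by (simp add: grid_def cells_def)
    qed
    then have "?c (t \<mu> - x \<mu>) \<le> ?c (t \<mu> - 1 - x \<mu>)" using bd[of \<mu>] by (intro mono) auto
    then show ?thesis using False unfolding dn_def
      by (simp add: nb_def cosh_weight_fun_upd self[of \<mu>] mult_right_mono pos del: of_int_diff)
  qed (simp add: nb_def)
  moreover have "?W (up \<mu> t) + ?W (dn \<mu> t) = 2 * cosh s * ?W t" for \<mu>
  proof -
    have "?c (n + 1) + ?c (n - 1) = 2 * cosh s * ?c n" for n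
      by (simp add: distrib_left right_diff_distrib cosh_add cosh_diff)
    moreover have "t \<mu> + 1 - x \<mu> = (t \<mu> - x \<mu>) + 1" "t \<mu> - 1 - x \<mu> = (t \<mu> - x \<mu>) - 1" by auto
    ultimately have "?c (t \<mu> + 1 - x \<mu>) + ?c (t \<mu> - 1 - x \<mu>) = 2 * cosh s * ?c (t \<mu> - x \<mu>)"
      by (simp only:)
    then show ?thesis
      unfolding up_def dn_def cosh_weight_fun_upd self[of \<mu>] distrib_right[symmetric] by (simp only: mult.assoc)
  qed
  ultimately have avg: "2 * ?W t + nb M ?W t (up \<mu> t) + nb M ?W t (dn \<mu> t) \<le> 2 * ?W t + 2 * cosh s * ?W t" for \<mu>
    by (smt (verit))
  have "walk M ?W t \<le> (\<Sum>\<mu>\<in>(UNIV::'d set). 2 * ?W t + 2 * cosh s * ?W t) / (4 * real CARD('d))"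
    unfolding walk_eq_average by (intro divide_right_mono sum_mono avg) auto
  also have "\<dots> = (1 + cosh s) / 2 * ?W t" by (simp add: field_simps)
  also have "\<dots> \<le> (1 + s\<^sup>2) * ?W t"
  proof -
    have "cosh s \<le> 1 + s\<^sup>2" using s by (intro cosh_le_quadratic) auto
    moreover have "0 \<le> s\<^sup>2" by simp
    ultimately have "1 + cosh s \<le> (1 + s\<^sup>2) * 2" by (simp only: distrib_right)
    then have "(1 + cosh s) / 2 \<le> 1 + s\<^sup>2" by (simp add: pos_divide_le_eq)
    then show ?thesis using W0 by (rule mult_right_mono)
  qed
  finally show ?thesis .
qed

text \<open>The price \<open>exp (n * s^2)\<close> is diffusive: it stays bounded for
  \<open>n\<close> of order \<open>b^2\<close> and \<open>s\<close> of order
  \<open>1 / b\<close>.\<close>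

lemma walk_exp_l1_le:
  fixes x :: "'d::finite \<Rightarrow> int"
  assumes x: "x \<in> grid M" and s: "0 \<le> s" "s \<le> 1"
  shows "(walk M ^^ n) (\<lambda>t. exp (s * l1 x t)) x \<le> 2 ^ CARD('d) * exp (real n * s\<^sup>2)"
proof -
  have iter: "(walk M ^^ n) (cosh_weight s x) t \<le> (1 + s\<^sup>2) ^ n * cosh_weight s x t" if "t \<in> grid M" for t n
    using that
  proof (induction n arbitrary: t)
    case (Suc n)
    have "(walk M ^^ Suc n) (cosh_weight s x) t \<le> walk M (\<lambda>z. (1 + s\<^sup>2) ^ n * cosh_weight s x z) t"
      using Suc by (auto intro: walk_mono)
    also have "\<dots> = (1 + s\<^sup>2) ^ n * walk M (cosh_weight s x) t" by (simp add: walk_cmult)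
    also have "\<dots> \<le> (1 + s\<^sup>2) ^ n * ((1 + s\<^sup>2) * cosh_weight s x t)"
      using walk_cosh_weight_le[OF x Suc.prems s] by (intro mult_left_mono) auto
    finally show ?case by (simp add: mult_ac)
  qed simp
  have "(walk M ^^ n) (\<lambda>t. exp (s * l1 x t)) x \<le> (walk M ^^ n) (\<lambda>t. 2 ^ CARD('d) * cosh_weight s x t) x"
    using s by (intro walk_iter_mono[OF x] exp_l1_le_cosh_weight)
  also have "\<dots> = 2 ^ CARD('d) * (walk M ^^ n) (cosh_weight s x) x" by (simp add: walk_iter_cmult)
  also have "\<dots> \<le> 2 ^ CARD('d) * ((1 + s\<^sup>2) ^ n * cosh_weight s x x)"
    by (intro mult_left_mono iter x) auto
  also have "\<dots> = 2 ^ CARD('d) * (1 + s\<^sup>2) ^ n" by (simp add: cosh_weight_def)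
  also have "\<dots> \<le> 2 ^ CARD('d) * exp (s\<^sup>2) ^ n"
    by (intro mult_left_mono power_mono exp_ge_add_one_self) auto
  also have "exp (s\<^sup>2) ^ n = exp (real n * s\<^sup>2)" by (simp add: exp_of_nat_mult)
  finally show ?thesis .
qed

text \<open>By the triangle inequality a weight decaying away from \<open>p\<close> is at most its
  value at \<open>x\<close> times a weight growing away from \<open>x\<close>.\<close>

lemma walk_exp_decay_le:
  fixes x :: "'d::finite \<Rightarrow> int"
  assumes x: "x \<in> grid M" and s: "0 \<le> s" "s \<le> 1"
  shows "(walk M ^^ n) (\<lambda>t. exp (- (s * l1 p t))) x \<le> 2 ^ CARD('d) * exp (real n * s\<^sup>2) * exp (- (s * l1 p x))"
proof -
  have "(walk M ^^ n) (\<lambda>t. exp (- (s * l1 p t))) x \<le> (walk M ^^ n) (\<lambda>t. exp (- (s * l1 p x)) * exp (s * l1 x t)) x"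
  proof (rule walk_iter_mono[OF x])
    fix t
    have "s * l1 p x \<le> s * (l1 p t + l1 x t)"
      using l1_triangle[of p x t] s by (intro mult_left_mono) (auto simp: l1_commute[of t x])
    then show "exp (- (s * l1 p t)) \<le> exp (- (s * l1 p x)) * exp (s * l1 x t)"
      by (simp add: exp_add[symmetric] distrib_left)
  qed
  also have "\<dots> = exp (- (s * l1 p x)) * (walk M ^^ n) (\<lambda>t. exp (s * l1 x t)) x"
    by (simp add: walk_iter_cmult)
  also have "\<dots> \<le> exp (- (s * l1 p x)) * (2 ^ CARD('d) * exp (real n * s\<^sup>2))"
    by (intro mult_left_mono walk_exp_l1_le x s) auto
  finally show ?thesis by (simp add: mult_ac)
qed

text \<open>A discrete Duhamel formula: the source is propagated for each \<open>j < n\<close>, at a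
  price bounded by that of \<open>n\<close> steps.\<close>

lemma subsolution_iterate:
  fixes V :: "('d::finite \<Rightarrow> int) \<Rightarrow> real"
  assumes V: "\<And>x. x \<in> grid M \<Longrightarrow> V x \<le> walk M V x + c * exp (- (s * l1 p x))"
    and x: "x \<in> grid M" and s: "0 \<le> s" "s \<le> 1" and c: "0 \<le> c"
  shows "V x \<le> (walk M ^^ n) V x + c * real n * (2 ^ CARD('d) * exp (real n * s\<^sup>2)) * exp (- (s * l1 p x))"
proof -
  let ?E = "\<lambda>t. exp (- (s * l1 p t))"
  have "V x \<le> (walk M ^^ n) V x + (\<Sum>j<n. c * (walk M ^^ j) ?E x)"
  proof (induction n)
    case (Suc n)
    have "(walk M ^^ n) V x \<le> (walk M ^^ n) (\<lambda>t. walk M V t + c * ?E t) x"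
      by (intro walk_iter_mono x V)
    also have "\<dots> = (walk M ^^ Suc n) V x + c * (walk M ^^ n) ?E x"
      unfolding walk_iter_add walk_iter_cmult funpow_Suc_right by simp
    finally show ?case using Suc by simp
  qed simp
  also have "(\<Sum>j<n. c * (walk M ^^ j) ?E x) \<le> (\<Sum>j<n. c * (2 ^ CARD('d) * exp (real n * s\<^sup>2) * ?E x))"
  proof (intro sum_mono mult_left_mono c)
    fix j assume "j \<in> {..<n}"
    then have "real j * s\<^sup>2 \<le> real n * s\<^sup>2" by (intro mult_right_mono) auto
    then have "2 ^ CARD('d) * exp (real j * s\<^sup>2) * ?E x \<le> 2 ^ CARD('d) * exp (real n * s\<^sup>2) * ?E x"
      by (intro mult_right_mono mult_left_mono) auto
    then show "(walk M ^^ j) ?E x \<le> 2 ^ CARD('d) * exp (real n * s\<^sup>2) * ?E x"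
      using walk_exp_decay_le[OF x s, of j p] by linarith
  qed
  finally show ?thesis by (simp add: mult_ac)
qed

subsection \<open>Existence and uniqueness\<close>

text \<open>Gaussian elimination by induction on the support: \<open>e\<close> is the unit vector at
  \<open>s\<close>, corrected on \<open>S\<close> so that \<open>A e\<close> vanishes there. Adding
  a multiple of \<open>e\<close> then solves the new equation without disturbing the old
  ones.\<close>

lemma positive_definite_solvable:
  fixes A :: "('a \<Rightarrow> real) \<Rightarrow> 'a \<Rightarrow> real"
  assumes fin: "finite S"
    and lin: "\<And>u v c z. A (\<lambda>x. u x + c * v x) z = A u z + c * A v z"
    and pd: "\<And>u. (\<forall>x. x \<notin> S \<longrightarrow> u x = 0) \<Longrightarrow> \<exists>x. u x \<noteq> 0 \<Longrightarrow> 0 < (\<Sum>x\<in>S. u x * A u x)"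
  shows "\<exists>u. (\<forall>x. x \<notin> S \<longrightarrow> u x = 0) \<and> (\<forall>x\<in>S. A u x = f x)"
  using fin pd
proof (induction S arbitrary: f rule: finite_induct)
  case empty
  then show ?case by (intro exI[of _ "\<lambda>_. 0"]) simp
next
  case (insert s S)
  have pd: "0 < (\<Sum>x\<in>S. u x * A u x)" if "\<forall>x. x \<notin> S \<longrightarrow> u x = 0" "\<exists>x. u x \<noteq> 0" for u
    using insert.prems[of u] that insert.hyps by simp
  have IH: "\<exists>u. (\<forall>x. x \<notin> S \<longrightarrow> u x = 0) \<and> (\<forall>x\<in>S. A u x = g x)" for g
    by (rule insert.IH) (rule pd)
  define \<delta> :: "'a \<Rightarrow> real" where "\<delta> = (\<lambda>x. if x = s then 1 else 0)"
  obtain h where h: "\<forall>x. x \<notin> S \<longrightarrow> h x = 0" "\<forall>x\<in>S. A h x = - A \<delta> x"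
    using IH[of "\<lambda>x. - A \<delta> x"] by blast
  obtain g where g: "\<forall>x. x \<notin> S \<longrightarrow> g x = 0" "\<forall>x\<in>S. A g x = f x"
    using IH[of f] by blast
  define e where "e = (\<lambda>x. \<delta> x + 1 * h x)"
  have eS: "A e x = 0" if "x \<in> S" for x using that h(2) by (simp only: e_def lin)
  have es: "e s = 1" using h(1) insert.hyps by (simp add: e_def \<delta>_def)
  have "0 < (\<Sum>x\<in>insert s S. e x * A e x)"
    by (rule insert.prems) (use h(1) es in \<open>auto simp: e_def \<delta>_def intro!: exI[of _ s]\<close>)
  \<comment> \<open>In the pairing of \<open>e\<close> with \<open>A e\<close> only the term at
    \<open>s\<close> survives, so positivity makes it a usable pivot.\<close>
  then have pos: "0 < A e s" using insert.hyps es by (simp add: eS)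
  define c where "c = (f s - A g s) / A e s"
  show ?case
  proof (intro exI[of _ "\<lambda>x. g x + c * e x"] conjI allI impI ballI)
    fix x assume "x \<notin> insert s S"
    then show "g x + c * e x = 0" using g(1) h(1) by (simp add: e_def \<delta>_def)
  next
    fix x assume "x \<in> insert s S"
    then show "A (\<lambda>x. g x + c * e x) x = f x"
      unfolding lin using pos g(2) eS by (auto simp: c_def)
  qed
qed

section \<open>Solvability of the integer-grid equation\<close>

lemma ham_linear: "ham b M \<mu>0 \<alpha> (\<lambda>x. u x + c * v x) z = ham b M \<mu>0 \<alpha> u z + c * ham b M \<mu>0 \<alpha> v z"
proof -
  have nb: "nb M (\<lambda>x. u x + c * v x) z y = nb M u z y + c * nb M v z y" for y by (simp add: nb_def)
  have lap: "lap M (\<lambda>x. u x + c * v x) z = lap M u z + c * lap M v z"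
    unfolding lap_def nb sum_distrib_left sum.distrib[symmetric]
    by (intro sum.cong refl) (simp add: algebra_simps)
  have mean: "block_mean b M (\<lambda>x. u x + c * v x) z = block_mean b M u z + c * block_mean b M v z"
    by (simp add: block_mean_def sum.distrib add_divide_distrib flip: sum_distrib_left)
  show ?thesis unfolding ham_def lap mean by (simp add: algebra_simps)
qed

lemma ham_coercive:
  fixes u :: "('d::finite \<Rightarrow> int) \<Rightarrow> real"
  assumes b: "1 \<le> b" "int b \<le> M" "int b dvd M" and \<alpha>: "0 < \<alpha>" "\<alpha> \<le> 1" and \<mu>0: "0 \<le> \<mu>0"
  shows "gap \<alpha> CARD('d) * (\<Sum>x\<in>grid M. (u x)\<^sup>2) \<le> (\<Sum>x\<in>grid M. u x * ham b M \<mu>0 \<alpha> u x)"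
  using twisted_coercive[OF b less_imp_le[OF \<alpha>(1)] order_refl \<alpha>(2) \<mu>0, of "\<lambda>_. 0" 0 u] by simp

lemma ham_positive_definite:
  fixes u :: "('d::finite \<Rightarrow> int) \<Rightarrow> real"
  assumes b: "1 \<le> b" "int b \<le> M" "int b dvd M" and \<alpha>: "0 < \<alpha>" "\<alpha> \<le> 1" and \<mu>0: "0 \<le> \<mu>0"
    and supp: "\<forall>x. x \<notin> grid M \<longrightarrow> u x = 0" and nz: "\<exists>x. u x \<noteq> 0"
  shows "0 < (\<Sum>x\<in>grid M. u x * ham b M \<mu>0 \<alpha> u x)"
proof -
  obtain z where z: "u z \<noteq> 0" "z \<in> grid M" using supp nz by blast
  have "0 < (u z)\<^sup>2" using z by simp
  also have "\<dots> \<le> (\<Sum>x\<in>grid M. (u x)\<^sup>2)" using z by (intro member_le_sum) auto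
  finally have "0 < gap \<alpha> CARD('d) * (\<Sum>x\<in>grid M. (u x)\<^sup>2)" using \<alpha> by (simp add: gap_pos)
  then show ?thesis using ham_coercive[OF b \<alpha> \<mu>0, of u] by linarith
qed

lemma ham_unique_solution:
  fixes f :: "('d::finite \<Rightarrow> int) \<Rightarrow> real"
  assumes b: "1 \<le> b" "int b \<le> M" "int b dvd M" and \<alpha>: "0 < \<alpha>" "\<alpha> \<le> 1" and \<mu>0: "0 \<le> \<mu>0"
  shows "\<exists>!u. (\<forall>x. x \<notin> grid M \<longrightarrow> u x = 0) \<and> (\<forall>x\<in>grid M. ham b M \<mu>0 \<alpha> u x = f x)"
proof (rule ex_ex1I)
  show "\<exists>u. (\<forall>x. x \<notin> grid M \<longrightarrow> u x = 0) \<and> (\<forall>x\<in>grid M. ham b M \<mu>0 \<alpha> u x = f x)"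
    by (rule positive_definite_solvable) (auto simp: ham_linear intro: ham_positive_definite[OF b \<alpha> \<mu>0])
next
  fix u v
  assume u: "(\<forall>x. x \<notin> grid M \<longrightarrow> u x = 0) \<and> (\<forall>x\<in>grid M. ham b M \<mu>0 \<alpha> u x = f x)"
    and v: "(\<forall>x. x \<notin> grid M \<longrightarrow> v x = 0) \<and> (\<forall>x\<in>grid M. ham b M \<mu>0 \<alpha> v x = f x)"
  define w where "w = (\<lambda>x. u x + (-1) * v x)"
  have "ham b M \<mu>0 \<alpha> w x = 0" if "x \<in> grid M" for x
    unfolding w_def ham_linear using u v that by simp
  then have "(\<Sum>x\<in>grid M. w x * ham b M \<mu>0 \<alpha> w x) = 0" by simp
  moreover have "\<forall>x. x \<notin> grid M \<longrightarrow> w x = 0" using u v by (simp add: w_def)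
  ultimately have "w x = 0" for x
    using ham_positive_definite[OF b \<alpha> \<mu>0, of w] by (metis less_irrefl)
  then show "u = v" by (auto simp: w_def fun_eq_iff)
qed

subsection \<open>Pointwise decay on the integer grid\<close>

text \<open>Kato's inequality: \<open>\<bar>u\<bar>\<close> is a subsolution, whatever the mass \<open>\<mu>0\<close> is.\<close>

lemma lap_abs_le:
  fixes u :: "('d::finite \<Rightarrow> int) \<Rightarrow> real"
  assumes \<mu>0: "0 \<le> \<mu>0"
  shows "(real b)\<^sup>2 * lap M (\<lambda>z. \<bar>u z\<bar>) x \<le> \<bar>ham b M \<mu>0 \<alpha> u x - \<alpha> * block_mean b M u x\<bar>"
proof -
  have "lap M (\<lambda>z. \<bar>u z\<bar>) x \<le> sgn (u x) * lap M u x"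
    unfolding lap_def sum_distrib_left
  proof (intro sum_mono)
    fix \<mu>
    have "\<bar>u x\<bar> - nb M (\<lambda>z. \<bar>u z\<bar>) x z \<le> sgn (u x) * (u x - nb M u x z)" for z
    proof -
      have "nb M (\<lambda>z. \<bar>u z\<bar>) x z = \<bar>nb M u x z\<bar>" by (simp add: nb_def)
      then show ?thesis by (auto simp: sgn_if abs_if)
    qed
    from this[of "up \<mu> x"] this[of "dn \<mu> x"]
    show "(\<bar>u x\<bar> - nb M (\<lambda>z. \<bar>u z\<bar>) x (up \<mu> x)) + (\<bar>u x\<bar> - nb M (\<lambda>z. \<bar>u z\<bar>) x (dn \<mu> x))
      \<le> sgn (u x) * ((u x - nb M u x (up \<mu> x)) + (u x - nb M u x (dn \<mu> x)))"
      unfolding distrib_left by (rule add_mono)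
  qed
  then have "(real b)\<^sup>2 * lap M (\<lambda>z. \<bar>u z\<bar>) x \<le> (real b)\<^sup>2 * (sgn (u x) * lap M u x)"
    by (rule mult_left_mono) simp
  also have "\<dots> = sgn (u x) * (ham b M \<mu>0 \<alpha> u x - \<alpha> * block_mean b M u x) - \<mu>0 * \<bar>u x\<bar>"
    by (simp add: ham_def algebra_simps abs_sgn)
  also have "\<dots> \<le> sgn (u x) * (ham b M \<mu>0 \<alpha> u x - \<alpha> * block_mean b M u x)" using \<mu>0 by simp
  also have "\<dots> \<le> \<bar>ham b M \<mu>0 \<alpha> u x - \<alpha> * block_mean b M u x\<bar>" by (auto simp: sgn_if)
  finally show ?thesis .
qed

text \<open>The first summand bounds the initial value carried through the walk, by Cauchy-Schwarz
  and ultracontractivity; the second bounds the accumulated sources.\<close>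

definition amplitude :: "real \<Rightarrow> nat \<Rightarrow> real" where
  "amplitude \<alpha> d = sqrt (72 * 4 ^ d * exp (16 * real (mixing d))) / gap \<alpha> d
     + (3 + 18 / gap \<alpha> d) * real (mixing d) * (2 ^ d * exp (4 * real (mixing d)))"

lemma amplitude_pos: "0 < \<alpha> \<Longrightarrow> 0 < amplitude \<alpha> d"
  unfolding amplitude_def using gap_pos[of \<alpha> d]
  by (intro add_pos_nonneg divide_pos_pos mult_nonneg_nonneg add_nonneg_nonneg) auto

text \<open>Within one block the weight varies by a factor of at most \<open>exp 1 \<le> 3\<close>,
  so Cauchy-Schwarz on the block turns the weighted square sum into a pointwise bound for the
  mean.\<close>

lemma block_mean_decay:
  fixes u :: "('d::finite \<Rightarrow> int) \<Rightarrow> real"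
  assumes b: "1 \<le> b" "int b \<le> M" "int b dvd M" and s: "0 \<le> s" "s * (real CARD('d) * real b) \<le> 1"
    and x: "x \<in> grid M" and C: "0 \<le> C"
    and S: "(\<Sum>z\<in>grid M. (exp (s * l1 p z) * u z)\<^sup>2) \<le> C\<^sup>2 * real b ^ CARD('d)"
  shows "\<bar>block_mean b M u x\<bar> \<le> 3 * C * exp (- (s * l1 p x))"
proof -
  define B where "B = real b ^ CARD('d)"
  let ?t = "tile (int b) M (tile_of b M x)"
  let ?r = "3 * exp (- (s * l1 p x))"
  have B: "0 < B" using b by (simp add: B_def)
  have card: "real (card ?t) = B"
    using b coarse_in_grid[of "int b" M x] x unfolding B_def by (subst card_tile_eq) (auto simp: tile_of_def)
  have "(\<Sum>z\<in>?t. (u z)\<^sup>2) \<le> (\<Sum>z\<in>?t. ?r\<^sup>2 * (exp (s * l1 p z) * u z)\<^sup>2)"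
  proof (intro sum_mono)
    fix z assume "z \<in> ?t"
    then have "z \<in> grid M" "tile_of b M x = tile_of b M z" by (auto simp: tile_def tile_of_def)
    then have "l1 x z \<le> real CARD('d) * real b" using l1_tile[OF b x] by blast
    then have "s * l1 x z \<le> s * (real CARD('d) * real b)" using s by (intro mult_left_mono) auto
    moreover have "s * l1 p x \<le> s * (l1 p z + l1 x z)"
      using l1_triangle[of p x z] s by (intro mult_left_mono) (auto simp: l1_commute[of z x])
    ultimately have "0 \<le> 1 - s * l1 p x + s * l1 p z" using s by (simp add: distrib_left)
    then have "1 \<le> exp (1 - s * l1 p x + s * l1 p z)" by simp
    also have "\<dots> = exp 1 * (exp (- (s * l1 p x)) * exp (s * l1 p z))"
      by (simp add: exp_add[symmetric])
    also have "\<dots> \<le> 3 * (exp (- (s * l1 p x)) * exp (s * l1 p z))"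
      using exp_le by (intro mult_right_mono) auto
    finally have "1 * \<bar>u z\<bar> \<le> 3 * (exp (- (s * l1 p x)) * exp (s * l1 p z)) * \<bar>u z\<bar>" by (rule mult_right_mono) simp
    then have "\<bar>u z\<bar>\<^sup>2 \<le> (?r * (exp (s * l1 p z) * \<bar>u z\<bar>))\<^sup>2" by (intro power_mono) (simp_all add: mult_ac)
    then show "(u z)\<^sup>2 \<le> ?r\<^sup>2 * (exp (s * l1 p z) * u z)\<^sup>2" by (simp add: power_mult_distrib)
  qed
  also have "\<dots> = ?r\<^sup>2 * (\<Sum>z\<in>?t. (exp (s * l1 p z) * u z)\<^sup>2)" by (simp only: sum_distrib_left)
  also have "\<dots> \<le> ?r\<^sup>2 * (\<Sum>z\<in>grid M. (exp (s * l1 p z) * u z)\<^sup>2)"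
    by (intro mult_left_mono sum_mono2) (auto simp: tile_def)
  also have "\<dots> \<le> ?r\<^sup>2 * (C\<^sup>2 * B)" using S unfolding B_def by (rule mult_left_mono) simp
  finally have L2: "(\<Sum>z\<in>?t. (u z)\<^sup>2) \<le> ?r\<^sup>2 * (C\<^sup>2 * B)" .
  have "(block_mean b M u x)\<^sup>2 = (\<Sum>z\<in>?t. u z)\<^sup>2 / B\<^sup>2" by (simp add: block_mean_def B_def power_divide)
  also have "\<dots> \<le> (\<Sum>z\<in>?t. (u z)\<^sup>2) * B / B\<^sup>2"
    using sum_squared_le_sum_of_squares[of u ?t] by (intro divide_right_mono) (auto simp: card)
  also have "\<dots> \<le> ?r\<^sup>2 * (C\<^sup>2 * B) * B / B\<^sup>2"
    using L2 B by (intro divide_right_mono mult_right_mono) auto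
  also have "\<dots> = (?r * C)\<^sup>2" using B by (simp add: power_mult_distrib power2_eq_square)
  finally have "\<bar>block_mean b M u x\<bar> \<le> ?r * C" using C by (simp add: abs_le_square_iff[symmetric])
  then show ?thesis by (simp add: mult_ac)
qed

lemma discrete_decay:
  fixes u :: "('d::finite \<Rightarrow> int) \<Rightarrow> real"
  assumes b: "1 \<le> b" "int b \<le> M" "int b dvd M" and \<alpha>: "0 < \<alpha>0" "\<alpha>0 \<le> \<alpha>" "\<alpha> \<le> 1" and \<mu>0: "0 \<le> \<mu>0"
    and p: "p \<in> grid M"
    and u: "\<And>x. x \<in> grid M \<Longrightarrow> ham b M \<mu>0 \<alpha> u x = (if tile_of b M x = tile_of b M p then 1 else 0)"
    and x: "x \<in> grid M"
  shows "\<bar>u x\<bar> \<le> amplitude \<alpha>0 CARD('d) * exp (- (rate \<alpha>0 CARD('d) / real b * l1 p x))"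
proof -
  define \<rho> where "\<rho> = rate \<alpha>0 CARD('d)"
  define g where "g = gap \<alpha>0 CARD('d)"
  define s where "s = \<rho> / real b"
  define K where "K = real (mixing CARD('d))"
  define n where "n = 4 * mixing CARD('d) * b\<^sup>2"
  define V where "V = (\<lambda>z. \<bar>u z\<bar>)"
  define h where "h = 3 + 18 / g"
  let ?d = "real CARD('d)"
  let ?E = "\<lambda>z. exp (- (s * l1 p z))"
  have d1: "1 \<le> ?d" by (simp add: Suc_le_eq)
  have \<rho>: "0 < \<rho>" "?d * \<rho> \<le> 1 / 2"
    using \<alpha> rate_pos[of \<alpha>0 "CARD('d)"] rate_le[of \<alpha>0 "CARD('d)"] by (auto simp: \<rho>_def)
  have "1 * \<rho> \<le> ?d * \<rho>" using d1 \<rho> by (intro mult_right_mono) auto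
  then have \<rho>1: "\<rho> \<le> 1 / 2" using \<rho>(2) by linarith
  have g: "0 < g" using \<alpha> by (simp add: g_def gap_pos)
  have b1: "1 \<le> real b" using b by simp
  have "s \<le> \<rho> / 1" unfolding s_def using b1 \<rho> by (intro divide_left_mono) auto
  \<comment> \<open>The rate \<open>2 * s\<close> is that of the squared decay weight, which is
    propagated below; it turns \<open>4 * K\<close> into \<open>16 * K\<close>.\<close>
  then have s: "0 < s" "s \<le> 1" "2 * s \<le> 1" using \<rho>1 \<rho> b1 by (auto simp: s_def)
  have "\<rho>\<^sup>2 \<le> 1\<^sup>2" using \<rho>1 \<rho> by (intro power_mono) auto
  moreover have "real n * s\<^sup>2 = 4 * K * \<rho>\<^sup>2" using b1 by (simp add: n_def s_def K_def power_divide)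
  ultimately have ns: "real n * s\<^sup>2 \<le> 4 * K"
    using mult_left_mono[of "\<rho>\<^sup>2" 1 "4 * K"] by (simp add: K_def)
  have K: "0 \<le> K" by (simp add: K_def)

  have "(6 / g)\<^sup>2 = 36 / g\<^sup>2" by (simp add: power_divide)
  then have S: "(\<Sum>z\<in>grid M. (exp (s * l1 p z) * u z)\<^sup>2) \<le> (6 / g)\<^sup>2 * real b ^ CARD('d)"
    using combes_thomas[OF b \<alpha> \<mu>0 p u] by (simp add: s_def \<rho>_def g_def)
  have sdb: "s * (?d * real b) \<le> 1" using \<rho> b1 by (simp add: s_def mult.commute)

  have rhs: "\<bar>ham b M \<mu>0 \<alpha> u z - \<alpha> * block_mean b M u z\<bar> \<le> h * ?E z" if z: "z \<in> grid M" for z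
  proof -
    have "ham b M \<mu>0 \<alpha> u z \<le> 3 * ?E z \<and> 0 \<le> ham b M \<mu>0 \<alpha> u z"
    proof (cases "tile_of b M z = tile_of b M p")
      case True
      have "s * l1 p z \<le> s * (?d * real b)"
        using l1_tile[OF b p z] True s by (intro mult_left_mono) auto
      then have "0 \<le> 1 - s * l1 p z" using sdb by linarith
      then have "1 \<le> exp (1 - s * l1 p z)" by simp
      also have "\<dots> = exp 1 * ?E z" by (simp add: exp_add[symmetric])
      also have "\<dots> \<le> 3 * ?E z" using exp_le by (intro mult_right_mono) auto
      finally show ?thesis using u[OF z] True by simp
    qed (use u[OF z] in simp)
    \<comment> \<open>The constant \<open>6 / g\<close> is the root of the Combes-Thomas bound;
      three times it is the \<open>18 / g\<close> in \<open>h\<close>.\<close>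
    moreover have "\<bar>\<alpha> * block_mean b M u z\<bar> \<le> 1 * (3 * (6 / g) * ?E z)"
      unfolding abs_mult using \<alpha> s g by (intro mult_mono block_mean_decay[OF b _ sdb z _ S]) auto
    ultimately have "\<bar>ham b M \<mu>0 \<alpha> u z - \<alpha> * block_mean b M u z\<bar> \<le> 3 * ?E z + 3 * (6 / g) * ?E z" by linarith
    then show ?thesis by (simp add: h_def distrib_right)
  qed
  \<comment> \<open>The source after division by \<open>b^2\<close> from \<open>ham\<close> and by
    \<open>4 * d\<close> from \<open>walk\<close>; over \<open>n\<close> steps it totals
    \<open>h * K / d\<close>, free of \<open>b\<close>.\<close>
  define c where "c = h / (4 * ?d * (real b)\<^sup>2)"
  have c: "0 \<le> c" using g by (simp add: c_def h_def)
  have sub: "V z \<le> walk M V z + c * ?E z" if z: "z \<in> grid M" for z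
  proof -
    have "(real b)\<^sup>2 * lap M V z \<le> h * ?E z"
      using lap_abs_le[OF \<mu>0, of b M u z \<alpha>] rhs[OF z] unfolding V_def by linarith
    then have "(real b)\<^sup>2 * lap M V z / (4 * ?d * (real b)\<^sup>2) \<le> h * ?E z / (4 * ?d * (real b)\<^sup>2)"
      by (intro divide_right_mono) auto
    then have "lap M V z / (4 * ?d) \<le> c * ?E z" using b1 by (simp add: c_def)
    then show ?thesis by (simp add: walk_def)
  qed
  have V: "V x \<le> (walk M ^^ n) V x + c * real n * (2 ^ CARD('d) * exp (real n * s\<^sup>2)) * ?E x"
    using sub x s c by (intro subsolution_iterate) auto
  have "c * real n = h * K / ?d" using b1 by (simp add: c_def n_def K_def)
  also have "\<dots> \<le> h * K / 1" using d1 K g by (intro divide_left_mono) (auto simp: h_def)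
  finally have cn: "c * real n \<le> h * K" by simp
  have second: "c * real n * (2 ^ CARD('d) * exp (real n * s\<^sup>2)) * ?E x \<le> h * K * (2 ^ CARD('d) * exp (4 * K)) * ?E x"
  proof (intro mult_right_mono mult_mono[OF cn])
    show "2 ^ CARD('d) * exp (real n * s\<^sup>2) \<le> 2 ^ CARD('d) * exp (4 * K)" using ns by simp
    show "0 \<le> h * K" using K g by (simp add: h_def)
  qed auto

  define C where "C = 2 * 2 ^ CARD('d) / real b ^ CARD('d)"
  have "(walk M ^^ n) (\<lambda>z. (exp (s * l1 p z) * V z)\<^sup>2) x \<le> C * (\<Sum>z\<in>grid M. (exp (s * l1 p z) * V z)\<^sup>2)"
    unfolding n_def C_def by (rule walk_ultracontractive[OF x b(1,2)]) simp
  also have "\<dots> \<le> C * ((6 / g)\<^sup>2 * real b ^ CARD('d))"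
    using S by (intro mult_left_mono) (auto simp: C_def V_def power_mult_distrib)
  \<comment> \<open>Here ultracontractivity cancels the volume \<open>b ^ d\<close> of the source
    block.\<close>
  also have "\<dots> = 72 * 2 ^ CARD('d) / g\<^sup>2" using b1 by (simp add: C_def power_divide)
  finally have w1: "(walk M ^^ n) (\<lambda>z. (exp (s * l1 p z) * V z)\<^sup>2) x \<le> 72 * 2 ^ CARD('d) / g\<^sup>2" .
  have E2: "(?E z)\<^sup>2 = exp (- (2 * s * l1 p z))" for z
    by (simp only: exp_double[symmetric] mult_minus_right mult.assoc)
  have "(walk M ^^ n) (\<lambda>z. (?E z)\<^sup>2) x = (walk M ^^ n) (\<lambda>z. exp (- (2 * s * l1 p z))) x"
    by (simp only: E2)
  also have "\<dots> \<le> 2 ^ CARD('d) * exp (real n * (2 * s)\<^sup>2) * exp (- (2 * s * l1 p x))"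
    using s by (intro walk_exp_decay_le x) auto
  also have "\<dots> \<le> 2 ^ CARD('d) * exp (16 * K) * (?E x)\<^sup>2"
  proof -
    have "real n * (2 * s)\<^sup>2 = 4 * (real n * s\<^sup>2)" by (simp add: power_mult_distrib)
    then have "real n * (2 * s)\<^sup>2 \<le> 16 * K" using ns by linarith
    then show ?thesis unfolding E2 by simp
  qed
  finally have w2: "(walk M ^^ n) (\<lambda>z. (?E z)\<^sup>2) x \<le> 2 ^ CARD('d) * exp (16 * K) * (?E x)\<^sup>2" .
  \<comment> \<open>This splitting feeds Cauchy-Schwarz: \<open>w1\<close> controls the square of
    the first factor, and \<open>w2\<close> returns the decay from the second.\<close>
  have "V = (\<lambda>z. (exp (s * l1 p z) * V z) * ?E z)"
  proof
    fix z
    have "exp (s * l1 p z) * ?E z = 1" by (simp add: exp_minus)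
    then show "V z = (exp (s * l1 p z) * V z) * ?E z" by (simp add: mult.commute mult.left_commute)
  qed
  then have "((walk M ^^ n) V x)\<^sup>2 = ((walk M ^^ n) (\<lambda>z. (exp (s * l1 p z) * V z) * ?E z) x)\<^sup>2"
    by (rule arg_cong)
  also have "\<dots> \<le> (walk M ^^ n) (\<lambda>z. (exp (s * l1 p z) * V z)\<^sup>2) x * (walk M ^^ n) (\<lambda>z. (?E z)\<^sup>2) x"
    by (rule walk_iter_cauchy_schwarz[OF x])
  also have "\<dots> \<le> 72 * 2 ^ CARD('d) / g\<^sup>2 * (2 ^ CARD('d) * exp (16 * K) * (?E x)\<^sup>2)"
    by (intro mult_mono w1 w2 walk_iter_nonneg[OF x]) auto
  also have "\<dots> = (sqrt (72 * 4 ^ CARD('d) * exp (16 * K)) / g * ?E x)\<^sup>2"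
  proof -
    have "(4::real) ^ CARD('d) = 2 ^ CARD('d) * 2 ^ CARD('d)" by (simp flip: power_mult_distrib)
    then show ?thesis by (simp add: power_mult_distrib power_divide)
  qed
  finally have first: "(walk M ^^ n) V x \<le> sqrt (72 * 4 ^ CARD('d) * exp (16 * K)) / g * ?E x"
    by (rule power2_le_imp_le) (use g in auto)
  have "\<bar>u x\<bar> \<le> sqrt (72 * 4 ^ CARD('d) * exp (16 * K)) / g * ?E x + h * K * (2 ^ CARD('d) * exp (4 * K)) * ?E x"
    using V first second unfolding V_def by linarith
  also have "\<dots> = amplitude \<alpha>0 CARD('d) * ?E x"
    by (simp only: amplitude_def K_def g_def h_def distrib_right)
  finally show ?thesis by (simp add: s_def \<rho>_def)
qed

subsection \<open>Transfer to the lattice of spacing \<open>eta\<close>\<close>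

definition emb :: "nat \<Rightarrow> nat \<Rightarrow> ('d::finite \<Rightarrow> int) \<Rightarrow> real^'d" where
  "emb L k n = (\<chi> \<mu>. eta L k * real_of_int (n \<mu>))"

lemma eta_pos: "0 < L \<Longrightarrow> 0 < eta L k"
  by (simp add: eta_def)

lemma emb_nth [simp]: "emb L k n $ \<mu> = eta L k * real_of_int (n \<mu>)"
  by (simp add: emb_def)

lemma inj_emb: "0 < L \<Longrightarrow> inj (emb L k)"
  using eta_pos[of L k] by (auto simp: inj_on_def vec_eq_iff fun_eq_iff)

lemma Omega_eq_emb:
  assumes "0 < L" shows "Omega L k m = emb L k ` grid (int (L ^ m))"
proof (intro set_eqI iffI)
  fix x :: "real^'a" assume "x \<in> Omega L k m"
  then have "\<forall>\<mu>. \<exists>n::nat. n < L ^ m \<and> x $ \<mu> = eta L k * real n" by (simp add: Omega_def)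
  then obtain n where n: "\<And>\<mu>. n \<mu> < L ^ m" "\<And>\<mu>. x $ \<mu> = eta L k * real (n \<mu>)" by metis
  have "x = emb L k (\<lambda>\<mu>. int (n \<mu>))" using n by (simp add: vec_eq_iff)
  moreover have "(\<lambda>\<mu>. int (n \<mu>)) \<in> grid (int (L ^ m))"
    using n by (simp add: grid_def cells_def del: of_nat_power)
  ultimately show "x \<in> emb L k ` grid (int (L ^ m))" by blast
next
  fix x :: "real^'a" assume "x \<in> emb L k ` grid (int (L ^ m))"
  then obtain n where n: "x = emb L k n" "\<And>\<mu>. 0 \<le> n \<mu>" "\<And>\<mu>. n \<mu> < int (L ^ m)"
    by (auto simp: grid_def cells_def)
  show "x \<in> Omega L k m" unfolding Omega_def mem_Collect_eq
  proof
    fix \<mu>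
    have "nat (n \<mu>) < L ^ m" using n(2,3)[of \<mu>] by linarith
    then show "\<exists>j::nat. j < L ^ m \<and> x $ \<mu> = eta L k * real j"
      using n(2)[of \<mu>] n(1) by (intro exI[of _ "nat (n \<mu>)"]) simp
  qed
qed

lemma emb_in_Omega_iff: "0 < L \<Longrightarrow> emb L k n \<in> Omega L k m \<longleftrightarrow> n \<in> grid (int (L ^ m))"
  unfolding Omega_eq_emb by (rule inj_image_mem_iff[OF inj_emb])

lemma NeumannLap_emb:
  assumes L: "0 < L"
  shows "NeumannLap L k m g (emb L k n) = - ((real (L ^ k))\<^sup>2 * lap (int (L ^ m)) (\<lambda>z. g (emb L k z)) n)"
proof -
  have up: "emb L k n + eta L k *\<^sub>R axis \<mu> 1 = emb L k (up \<mu> n)" for \<mu>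
    by (simp add: vec_eq_iff up_def axis_def algebra_simps)
  have dn: "emb L k n - eta L k *\<^sub>R axis \<mu> 1 = emb L k (dn \<mu> n)" for \<mu>
    by (simp add: vec_eq_iff dn_def axis_def algebra_simps)
  have nb: "nbval L k m g (emb L k n) (emb L k z) = nb (int (L ^ m)) (\<lambda>z. g (emb L k z)) n z" for z
    by (simp only: nbval_def nb_def emb_in_Omega_iff[OF L])
  have "1 / (eta L k)\<^sup>2 = (real (L ^ k))\<^sup>2" by (simp add: eta_def power_divide)
  then show ?thesis
    unfolding NeumannLap_def lap_def up dn nb minus_mult_right sum_negf[symmetric]
    by (intro arg_cong2[where f="(*)"] sum.cong) auto
qed

lemma floor_emb: "0 < L \<Longrightarrow> \<lfloor>emb L k n $ \<mu>\<rfloor> = n \<mu> div int (L ^ k)"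
  using floor_divide_of_int_eq[of "n \<mu>" "int (L ^ k)"] by (simp add: eta_def)

section \<open>Blocks of the fine lattice as tiles\<close>

lemma div_less_div:
  fixes b n M :: int
  assumes b: "0 < b" "b dvd M" and n: "n < M"
  shows "n div b < M div b"
proof (rule mult_right_less_imp_less)
  have "n div b * b \<le> n" using b by (simp add: minus_mod_eq_div_mult[symmetric])
  also have "n < M div b * b" using b n by simp
  finally show "n div b * b < M div b * b" .
qed (use b in simp)

text \<open>When \<open>b\<close> divides \<open>M\<close> there is no remainder, so the cap in
  \<open>coarse\<close> is never active.\<close>

lemma coarse_eq_div:
  assumes b: "0 < b" "b dvd M" and n: "n < M"
  shows "coarse b M n = n div b"
  using div_less_div[OF assms] by (simp add: coarse_def)

lemma tile_of_grid:
  assumes b: "0 < b" "int b dvd M" and n: "n \<in> grid M"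
  shows "tile_of b M n = (\<lambda>\<mu>. n \<mu> div int b)"
  using coarse_eq_div[of "int b" M] b n by (simp add: tile_of_def grid_def cells_def)

text \<open>\<open>Block\<close> is cut out of the infinite lattice, whereas a tile lies in the
  grid. They agree because divisibility keeps the whole block of a grid point inside.\<close>

lemma Block_eq_emb_tile:
  fixes n :: "'d::finite \<Rightarrow> int"
  assumes L: "0 < L" and km: "k \<le> m" and n: "n \<in> grid (int (L ^ m))"
  shows "Block L k (\<chi> \<mu>. real_of_int \<lfloor>emb L k n $ \<mu>\<rfloor>)
    = emb L k ` tile (int (L ^ k)) (int (L ^ m)) (tile_of (L ^ k) (int (L ^ m)) n)"
proof -
  define b where "b = int (L ^ k)"
  define M where "M = int (L ^ m)"
  have b: "0 < b" using L by (simp add: b_def)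
  have bM: "b dvd M" unfolding b_def M_def of_nat_dvd_iff using km by (rule le_imp_power_dvd)
  have e: "0 < eta L k" "eta L k * real_of_int b = 1" using L by (auto simp: eta_def b_def)
  have n': "0 \<le> n \<mu>" "n \<mu> < M" for \<mu> using n by (auto simp: grid_def cells_def M_def)
  have tile_of: "tile_of (L ^ k) M z = (\<lambda>\<mu>. z \<mu> div b)" if "z \<in> grid M" for z :: "'d \<Rightarrow> int"
    using tile_of_grid[of "L ^ k" M z] L bM that unfolding b_def by simp
  have nM: "n \<in> grid M" using n by (simp only: M_def)
  have tile: "tile b M (tile_of (L ^ k) M n) = {z. \<forall>\<mu>. z \<mu> div b = n \<mu> div b}"
  proof (intro set_eqI iffI)
    fix z assume z: "z \<in> tile b M (tile_of (L ^ k) M n)"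
    then have "z \<in> grid M" "tile_of (L ^ k) M z = tile_of (L ^ k) M n"
      by (auto simp: tile_def tile_of_def b_def)
    then show "z \<in> {z. \<forall>\<mu>. z \<mu> div b = n \<mu> div b}"
      unfolding tile_of[OF nM] tile_of[OF \<open>z \<in> grid M\<close>] fun_eq_iff mem_Collect_eq by blast
  next
    fix z assume "z \<in> {z. \<forall>\<mu>. z \<mu> div b = n \<mu> div b}"
    then have z: "z \<mu> div b = n \<mu> div b" for \<mu> by simp
    \<comment> \<open>Membership in the grid is recovered from the quotient alone: it is nonnegative
      and below \<open>M div b\<close>, and \<open>b\<close> divides \<open>M\<close>.\<close>
    have "0 \<le> z \<mu> \<and> z \<mu> < M" for \<mu>
    proof
      have "0 \<le> z \<mu> div b" using n'[of \<mu>] b unfolding z by (simp add: pos_imp_zdiv_nonneg_iff)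
      then show "0 \<le> z \<mu>" using b by (simp add: pos_imp_zdiv_nonneg_iff)
      have "z \<mu> div b < M div b" unfolding z by (rule div_less_div[OF b bM n'(2)])
      then have "(z \<mu> div b + 1) * b \<le> M div b * b" using b by (intro mult_right_mono) auto
      then have "(z \<mu> div b + 1) * b \<le> M" using bM by simp
      moreover have "z \<mu> = z \<mu> div b * b + z \<mu> mod b" by simp
      moreover have "z \<mu> mod b < b" using b by simp
      ultimately show "z \<mu> < M" unfolding distrib_right by linarith
    qed
    then have "z \<in> grid M" by (simp add: grid_def cells_def)
    moreover from this have "tile_of (L ^ k) M z = tile_of (L ^ k) M n"
      by (simp only: tile_of nM z)
    ultimately show "z \<in> tile b M (tile_of (L ^ k) M n)" by (simp add: tile_def tile_of_def b_def)
  qed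
  have cell: "real_of_int (n \<mu> div b) \<le> eta L k * real_of_int j \<and> eta L k * real_of_int j < real_of_int (n \<mu> div b) + 1
      \<longleftrightarrow> j div b = n \<mu> div b" for \<mu> j
  proof -
    have "eta L k * real_of_int j = real_of_int j / real_of_int b" by (simp add: eta_def b_def)
    then have floor: "\<lfloor>eta L k * real_of_int j\<rfloor> = j div b" by (simp add: floor_divide_of_int_eq)
    show ?thesis unfolding floor_eq_iff[symmetric] floor ..
  qed
  have "Block L k (\<chi> \<mu>. real_of_int (n \<mu> div b)) = emb L k ` {z. \<forall>\<mu>. z \<mu> div b = n \<mu> div b}"
  proof (intro set_eqI iffI)
    fix x assume "x \<in> Block L k (\<chi> \<mu>. real_of_int (n \<mu> div b))"
    then have x: "x $ \<mu> / eta L k \<in> \<int>" "real_of_int (n \<mu> div b) \<le> x $ \<mu>" "x $ \<mu> < real_of_int (n \<mu> div b) + 1" for \<mu>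
      by (auto simp: Block_def)
    have "\<exists>j. x $ \<mu> / eta L k = real_of_int j" for \<mu> using x(1)[of \<mu>] by (auto elim: Ints_cases)
    then obtain z where "\<And>\<mu>. x $ \<mu> / eta L k = real_of_int (z \<mu>)" by metis
    then have z: "x $ \<mu> = eta L k * real_of_int (z \<mu>)" for \<mu> using e by (simp add: field_simps)
    have "z \<mu> div b = n \<mu> div b" for \<mu> using x(2,3)[of \<mu>] cell[of \<mu> "z \<mu>"] by (simp add: z)
    moreover have "x = emb L k z" by (simp add: vec_eq_iff z)
    ultimately show "x \<in> emb L k ` {z. \<forall>\<mu>. z \<mu> div b = n \<mu> div b}" by blast
  next
    fix x assume "x \<in> emb L k ` {z. \<forall>\<mu>. z \<mu> div b = n \<mu> div b}"
    then obtain z where z: "x = emb L k z" "\<And>\<mu>. z \<mu> div b = n \<mu> div b" by auto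
    show "x \<in> Block L k (\<chi> \<mu>. real_of_int (n \<mu> div b))"
      using e cell z by (simp add: Block_def)
  qed
  then show ?thesis using L tile by (simp only: floor_emb b_def M_def)
qed

lemma Qop_emb:
  fixes n :: "'d::finite \<Rightarrow> int" and g :: "real^'d \<Rightarrow> real"
  assumes L: "0 < L" and km: "k \<le> m" and n: "n \<in> grid (int (L ^ m))"
  shows "Qadj (Qop L k g) (emb L k n) = block_mean (L ^ k) (int (L ^ m)) (\<lambda>z. g (emb L k z)) n"
  unfolding Qadj_def Qop_def Block_eq_emb_tile[OF assms] block_mean_def
  by (subst sum.reindex) (auto simp: power_mult intro: inj_on_subset[OF inj_emb[OF L]])

lemma Hop_emb:
  fixes n :: "'d::finite \<Rightarrow> int" and g :: "real^'d \<Rightarrow> real"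
  assumes L: "0 < L" and km: "k \<le> m" and n: "n \<in> grid (int (L ^ m))"
  shows "Hop a \<mu>0 L k m g (emb L k n)
    = ham (L ^ k) (int (L ^ m)) (mubar \<mu>0 L k) (a_k a L k) (\<lambda>z. g (emb L k z)) n"
  unfolding Hop_def ham_def NeumannLap_emb[OF L] Qop_emb[OF assms] by simp

text \<open>\<open>Gk\<close> is a definite description, so its equation is available only after
  unique existence, which is transported from the integer grid along the injection
  \<open>emb\<close>.\<close>

lemma Gk_emb:
  fixes f :: "real^'d \<Rightarrow> real"
  assumes L: "0 < L" and km: "k \<le> m" and \<alpha>: "0 < a_k a L k" "a_k a L k \<le> 1" and \<mu>0: "0 \<le> \<mu>0"
    and n: "n \<in> grid (int (L ^ m))"
  shows "ham (L ^ k) (int (L ^ m)) (mubar \<mu>0 L k) (a_k a L k) (\<lambda>z. Gk a \<mu>0 L k m f (emb L k z)) n = f (emb L k n)"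
proof -
  let ?H = "ham (L ^ k) (int (L ^ m)) (mubar \<mu>0 L k) (a_k a L k) :: (('d \<Rightarrow> int) \<Rightarrow> real) \<Rightarrow> ('d \<Rightarrow> int) \<Rightarrow> real"
  let ?G = "grid (int (L ^ m)) :: ('d \<Rightarrow> int) set"
  let ?P = "\<lambda>g. (\<forall>x. x \<notin> Omega L k m \<longrightarrow> g x = 0) \<and> (\<forall>x\<in>Omega L k m. Hop a \<mu>0 L k m g x = f x)"
  have b: "1 \<le> L ^ k" using L by simp
  have bM: "int (L ^ k) \<le> int (L ^ m)" unfolding of_nat_le_iff using L km by (intro power_increasing) auto
  have bd: "int (L ^ k) dvd int (L ^ m)" unfolding of_nat_dvd_iff using km by (rule le_imp_power_dvd)
  have mu: "0 \<le> mubar \<mu>0 L k" using \<mu>0 by (simp add: mubar_def)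
  let ?Q = "\<lambda>u. (\<forall>z. z \<notin> ?G \<longrightarrow> u z = 0) \<and> (\<forall>z\<in>?G. ?H u z = f (emb L k z))"
  have ex1: "\<exists>!u. ?Q u"
    by (rule ham_unique_solution[OF b bM bd \<alpha> mu])
  have P: "(\<forall>z. z \<notin> ?G \<longrightarrow> g (emb L k z) = 0) \<and> (\<forall>z\<in>?G. ?H (\<lambda>z. g (emb L k z)) z = f (emb L k z))"
    if "?P g" for g
  proof (intro conjI allI ballI impI)
    fix z :: "'d \<Rightarrow> int"
    show "g (emb L k z) = 0" if "z \<notin> ?G" using \<open>?P g\<close> that emb_in_Omega_iff[OF L, of k z m] by blast
    show "?H (\<lambda>z. g (emb L k z)) z = f (emb L k z)" if "z \<in> ?G"
      using \<open>?P g\<close> emb_in_Omega_iff[OF L, of k z m] that unfolding Hop_emb[OF L km that, symmetric] by blast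
  qed
  have "\<exists>!g. ?P g"
  proof (rule ex_ex1I)
    obtain u where "?Q u" using ex1 by (rule ex1E)
    then have u: "\<And>z. z \<notin> ?G \<Longrightarrow> u z = 0" "\<And>z. z \<in> ?G \<Longrightarrow> ?H u z = f (emb L k z)" by blast+
    \<comment> \<open>Extension by zero off \<open>Omega\<close>, as the description in
      \<open>Gk\<close> demands.\<close>
    define g where "g = (\<lambda>x. if x \<in> Omega L k m then u (inv (emb L k) x) else 0)"
    have g: "g (emb L k z) = u z" for z
      using u(1) by (simp add: g_def emb_in_Omega_iff[OF L] inv_f_f[OF inj_emb[OF L]])
    have "Hop a \<mu>0 L k m g x = f x" if x: "x \<in> Omega L k m" for x
    proof -
      obtain z where z: "z \<in> ?G" "x = emb L k z" using x unfolding Omega_eq_emb[OF L] by blast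
      then show ?thesis using Hop_emb[OF L km z(1), of a \<mu>0 g] u(2)[OF z(1)] by (simp add: g)
    qed
    moreover have "g x = 0" if "x \<notin> Omega L k m" for x using that by (simp add: g_def)
    ultimately show "\<exists>g. ?P g" by blast
  next
    fix g h assume gh: "?P g" "?P h"
    have eq: "(\<lambda>z. g (emb L k z)) = (\<lambda>z. h (emb L k z))"
    proof -
      obtain u where u: "\<forall>v. ?Q v \<longrightarrow> v = u" using ex1 by (rule ex1E)
      show ?thesis using u[rule_format, OF P[OF gh(1)]] u[rule_format, OF P[OF gh(2)]] by (simp only:)
    qed
    show "g = h"
    proof
      fix x
      show "g x = h x"
      proof (cases "x \<in> Omega L k m")
        case True
        then obtain z where "x = emb L k z" unfolding Omega_eq_emb[OF L] by blast
        then show ?thesis using eq by (simp add: fun_eq_iff)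
      qed (use gh in simp)
    qed
  qed
  then have "?P (Gk a \<mu>0 L k m f)" unfolding Gk_def by (rule theI')
  from P[OF this] n show ?thesis by blast
qed

text \<open>With \<open>t = L^(-2) \<le> 1/9\<close> the ratio \<open>(1 - t) / (1 - t^k)\<close>
  lies between 8/9 and 1; this removes k and L from the constants.\<close>

lemma a_k_bounds:
  assumes a: "0 < a" and L: "3 \<le> L" and k: "1 \<le> k"
  shows "8 * a / 9 \<le> a_k a L k" "a_k a L k \<le> a"
proof -
  define t where "t = 1 / (real L)\<^sup>2"
  have "(3::real)\<^sup>2 \<le> (real L)\<^sup>2" using L by (intro power_mono) auto
  then have t: "0 < t" "t \<le> 1 / 9" using L by (auto simp: t_def field_simps)
  have 1: "real L powi (- 2) = t" by (simp add: t_def power_int_minus inverse_eq_divide)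
  have "- 2 * int k = - int (2 * k)" by simp
  then have "real L powi (- 2 * int k) = inverse (real L ^ (2 * k))"
    by (simp only: power_int_minus power_int_of_nat)
  then have 2: "real L powi (- 2 * int k) = t ^ k"
    by (simp add: t_def power_mult power_one_over inverse_eq_divide)
  have "t ^ k \<le> t ^ 1" using t k by (intro power_decreasing) auto
  then have tk: "0 < t ^ k" "t ^ k \<le> t" using t by auto
  have q: "a_k a L k = a * ((1 - t) / (1 - t ^ k))" unfolding a_k_def 1 2 by simp
  have "8 / 9 \<le> (1 - t) / (1 - t ^ k)" using t tk by (simp add: pos_le_divide_eq)
  from mult_left_mono[OF this, of a] show "8 * a / 9 \<le> a_k a L k" using a by (simp add: q)
  have "(1 - t) / (1 - t ^ k) \<le> 1" using t tk by simp
  from mult_left_mono[OF this, of a] show "a_k a L k \<le> a" using a by (simp add: q)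
qed

theorem mainTheorem18:
  fixes a :: real
  assumes "0 < a" and "a \<le> 1"
  shows "\<exists>c c1::real. c > 0 \<and> c1 > 0 \<and>
    (\<forall>(L::nat) (k::nat) (m::nat) (\<mu>0::real) (x::real^'d) (y::real^'d).
       odd L \<and> L > 1 \<and> k \<ge> 1 \<and> m \<ge> k \<and> \<mu>0 \<ge> 0 \<and>
       x \<in> Omega L k m \<and> y \<in> Omegak L k m \<longrightarrow>
       \<bar>GQkernel a \<mu>0 L k m x y\<bar> \<le> c * exp (- c1 * norm (x - y)))"
proof (intro exI conjI allI impI)
  \<comment> \<open>The uniform lower bound for \<open>a_k\<close>, so both witnesses depend only on
    \<open>d\<close> and \<open>a\<close>.\<close>
  let ?\<alpha>0 = "8 * a / 9"
  show "0 < amplitude ?\<alpha>0 CARD('d)" using assms by (intro amplitude_pos) auto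
  show "0 < rate ?\<alpha>0 CARD('d)" using assms by (intro rate_pos) auto
  fix L k m :: nat and \<mu>0 :: real and x y :: "real^'d"
  assume A: "odd L \<and> L > 1 \<and> k \<ge> 1 \<and> m \<ge> k \<and> \<mu>0 \<ge> 0 \<and> x \<in> Omega L k m \<and> y \<in> Omegak L k m"
  \<comment> \<open>Oddness gives \<open>L \<ge> 3\<close>, which is what yields 8/9.\<close>
  then have "L \<noteq> 2" by auto
  then have L3: "3 \<le> L" and L: "0 < L" and km: "k \<le> m" and k: "1 \<le> k" and \<mu>0: "0 \<le> \<mu>0" using A by auto
  define b where "b = L ^ k"
  define M where "M = int (L ^ m)"
  have b: "1 \<le> b" using L by (simp add: b_def)
  have bM: "int b \<le> M" unfolding b_def M_def of_nat_le_iff using L km by (intro power_increasing) auto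
  have bd: "int b dvd M" unfolding b_def M_def of_nat_dvd_iff using km by (rule le_imp_power_dvd)
  note \<alpha> = a_k_bounds[OF assms(1) L3 k]
  obtain n where n: "n \<in> grid M" "x = emb L k n" using A unfolding Omega_eq_emb[OF L] M_def by blast
  have "\<forall>\<mu>. \<exists>q::nat. q < L ^ (m - k) \<and> y $ \<mu> = real q" using A by (simp add: Omegak_def)
  then obtain q where q: "\<And>\<mu>. q \<mu> < L ^ (m - k)" "\<And>\<mu>. y $ \<mu> = real (q \<mu>)" by metis
  \<comment> \<open>The lower corner of the block of \<open>y\<close>, in lattice steps.\<close>
  define p where "p = (\<lambda>\<mu>. int (q \<mu> * b))"
  have "q \<mu> * b < L ^ m" for \<mu>
  proof -
    have "q \<mu> * b < L ^ (m - k) * b" using q(1) b by simp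
    also have "\<dots> = L ^ m" using km by (simp add: b_def flip: power_add)
    finally show ?thesis .
  qed
  then have p: "p \<in> grid M" unfolding p_def M_def grid_def cells_def by (simp del: of_nat_power of_nat_mult)
  define u where "u = (\<lambda>z. Gk a \<mu>0 L k m (Qadj (indicator {y})) (emb L k z))"
  have u: "ham b M (mubar \<mu>0 L k) (a_k a L k) u z = (if tile_of b M z = tile_of b M p then 1 else 0)"
    if z: "z \<in> grid M" for z
  proof -
    have "tile_of b M z = tile_of b M p \<longleftrightarrow> (\<forall>\<mu>. z \<mu> div int b = int (q \<mu>))"
      using tile_of_grid[of b M z] tile_of_grid[of b M p] b bd z p by (auto simp: fun_eq_iff p_def)
    also have "\<dots> \<longleftrightarrow> (\<chi> \<mu>. real_of_int \<lfloor>emb L k z $ \<mu>\<rfloor>) = y"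
      unfolding floor_emb[OF L] b_def[symmetric] by (simp add: vec_eq_iff q(2)) (metis of_int_eq_iff of_int_of_nat_eq)
    finally have "Qadj (indicator {y}) (emb L k z) = (if tile_of b M z = tile_of b M p then 1 else (0::real))"
      by (simp add: Qadj_def indicator_def)
    moreover have "ham b M (mubar \<mu>0 L k) (a_k a L k) u z = Qadj (indicator {y}) (emb L k z)"
      unfolding u_def b_def M_def using \<alpha> assms z[unfolded M_def] by (intro Gk_emb L km \<mu>0) auto
    ultimately show ?thesis by simp
  qed
  have "\<bar>u n\<bar> \<le> amplitude ?\<alpha>0 CARD('d) * exp (- (rate ?\<alpha>0 CARD('d) / real b * l1 p n))"
    using \<alpha> assms \<mu>0 by (intro discrete_decay[OF b bM bd _ _ _ _ p u n(1)]) (auto simp: mubar_def)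
  also have "\<dots> \<le> amplitude ?\<alpha>0 CARD('d) * exp (- rate ?\<alpha>0 CARD('d) * norm (x - y))"
  proof -
    have "norm (x - y) \<le> (\<Sum>\<mu>\<in>UNIV. \<bar>(x - y) $ \<mu>\<bar>)" by (rule norm_le_l1_cart)
    also have "\<dots> = (\<Sum>\<mu>\<in>UNIV. \<bar>real_of_int (n \<mu>) - real_of_int (p \<mu>)\<bar> / real b)"
    proof (intro sum.cong refl)
      fix \<mu>
      \<comment> \<open>Since \<open>y\<close> is exactly this corner, rescaling by \<open>b\<close>
        is an identity and the bound centred at \<open>p\<close> transfers to \<open>y\<close>
        without loss.\<close>
      have "(x - y) $ \<mu> = (real_of_int (n \<mu>) - real_of_int (p \<mu>)) / real b"
        using L by (simp add: n(2) q(2) p_def eta_def b_def field_simps)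
      then show "\<bar>(x - y) $ \<mu>\<bar> = \<bar>real_of_int (n \<mu>) - real_of_int (p \<mu>)\<bar> / real b" by simp
    qed
    also have "\<dots> = l1 p n / real b" by (simp add: l1_def sum_divide_distrib)
    finally have "rate ?\<alpha>0 CARD('d) * norm (x - y) \<le> rate ?\<alpha>0 CARD('d) * (l1 p n / real b)"
      using assms rate_pos[of ?\<alpha>0 "CARD('d)"] by (intro mult_left_mono) auto
    then show ?thesis using amplitude_pos[of ?\<alpha>0 "CARD('d)"] assms by (intro mult_left_mono) auto
  qed
  finally show "\<bar>GQkernel a \<mu>0 L k m x y\<bar> \<le> amplitude ?\<alpha>0 CARD('d) * exp (- rate ?\<alpha>0 CARD('d) * norm (x - y))"
    by (simp add: GQkernel_def u_def n(2))
qed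

end
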